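(* There exists a constant $C$ such that the following holds for every integer $d \geq 1$ and all integers $n,k$: if $C^d \leq k \leq n-C^d$ and $f\colon \binom{[n]}{k} \to \{0,1\}$ has degree at most $d$, then $f$ depends on at most $\gamma(d)$ coordinates, i.e. $f$ is a $\gamma(d)$-junta.
   Context: Write $[n]=\{1,\ldots,n\}$. For $0\le k\le n$, the slice $\binom{[n]}{k}$ is the set of all $x\in\{0,1\}^n$ with $\sum_{i=1}^n x_i=k$. The degree of a function on the slice is the minimum degree of a real polynomial in $x_1,\ldots,x_n$ that agrees with the function on all points of the slice. A function $f$ on the slice is an $m$-junta (depends on at most $m$ coordinates) if there is a set $I\subseteq[n]$ with $|I|\le m$ such that $f(x)=g(x|_I)$ for some function $g\colon\{0,1\}^I\to\{0,1\}$, where $x|_I=(x_i)_{i\in I}$. On the hypercube $\{0,1\}^n$, the degree of a function is the degree of its unique multilinear polynomial representation over $\mathbb{R}$ (equivalently, the minimum degree of a real polynomial agreeing with it on $\{0,1\}^n$). A function $g$ on $\{0,1\}^n$ depends on coordinate $i$ if there are two points differing only in coordinate $i$ on which $g$ takes different values. $\gamma(d)$ denotes the maximum, over all $n$ and all functions $g\colon\{0,1\}^n\to\{0,1\}$ of degree at most $d$, of the number of coordinates that $g$ depends on. (By a theorem of Nisan and Szegedy this is finite, with $\gamma(d)\le d2^{d-1}$.) *)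

theory Defs
  imports Complex_Main "HOL-Library.FuncSet" "HOL-Library.Poly_Mapping"
begin

section \<open>Real polynomials in variables indexed by natural numbers\<close>

text \<open>A monomial is a finitely supported exponent vector, a polynomial a finitely supported
  family of coefficients. The ring structure is the one of \<open>HOL-Library.Poly_Mapping\<close>.\<close>

type_synonym monomial = "nat \<Rightarrow>\<^sub>0 nat"
type_synonym real_mpoly = "monomial \<Rightarrow>\<^sub>0 real"

definition monom_deg :: "monomial \<Rightarrow> nat" where
  "monom_deg m = (\<Sum>i\<in>Poly_Mapping.keys m. Poly_Mapping.lookup m i)"

definition monom_eval :: "monomial \<Rightarrow> (nat \<Rightarrow> real) \<Rightarrow> real" where
  "monom_eval m x = (\<Prod>i\<in>Poly_Mapping.keys m. x i ^ Poly_Mapping.lookup m i)"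

definition mpoly_eval :: "real_mpoly \<Rightarrow> (nat \<Rightarrow> real) \<Rightarrow> real" where
  "mpoly_eval p x = (\<Sum>m\<in>Poly_Mapping.keys p. Poly_Mapping.lookup p m * monom_eval m x)"

definition mpoly_vars :: "real_mpoly \<Rightarrow> nat set" where
  "mpoly_vars p = (\<Union>m\<in>Poly_Mapping.keys p. Poly_Mapping.keys m)"

text \<open>The zero polynomial gets degree \<open>0\<close>.\<close>

definition total_degree :: "real_mpoly \<Rightarrow> nat" where
  "total_degree p = Max (insert 0 (monom_deg ` Poly_Mapping.keys p))"

definition multilinear :: "real_mpoly \<Rightarrow> bool" where
  "multilinear p \<longleftrightarrow> (\<forall>m\<in>Poly_Mapping.keys p. \<forall>i. Poly_Mapping.lookup m i \<le> 1)"


section \<open>The hypercube and the slice\<close>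

text \<open>Points are functions on \<open>{1..n}\<close>, extended by \<^const>\<open>undefined\<close> outside, so that a point is
  determined by its coordinates. The entries \<open>0\<close> and \<open>1\<close> are reals so that polynomials can be
  evaluated at points without coercions.\<close>

definition hypercube :: "nat \<Rightarrow> (nat \<Rightarrow> real) set" where
  "hypercube n = {1..n} \<rightarrow>\<^sub>E {0, 1}"

definition slice :: "nat \<Rightarrow> nat \<Rightarrow> (nat \<Rightarrow> real) set" where
  "slice n k = {x \<in> hypercube n. (\<Sum>i=1..n. x i) = real k}"

definition slice_degree :: "nat \<Rightarrow> nat \<Rightarrow> ((nat \<Rightarrow> real) \<Rightarrow> real) \<Rightarrow> nat" where
  "slice_degree n k f = (LEAST d. \<exists>p. mpoly_vars p \<subseteq> {1..n} \<and> total_degree p = d \<and>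
     (\<forall>x\<in>slice n k. mpoly_eval p x = f x))"

definition slice_junta :: "nat \<Rightarrow> nat \<Rightarrow> nat \<Rightarrow> ((nat \<Rightarrow> real) \<Rightarrow> real) \<Rightarrow> bool" where
  "slice_junta n k m f \<longleftrightarrow> (\<exists>I\<subseteq>{1..n}. card I \<le> m \<and>
     (\<exists>g \<in> (I \<rightarrow>\<^sub>E {0, 1}) \<rightarrow> {0, 1}. \<forall>x\<in>slice n k. f x = g (restrict x I)))"

definition is_multilinear_rep :: "nat \<Rightarrow> ((nat \<Rightarrow> real) \<Rightarrow> real) \<Rightarrow> real_mpoly \<Rightarrow> bool" where
  "is_multilinear_rep n g p \<longleftrightarrow> multilinear p \<and> mpoly_vars p \<subseteq> {1..n} \<and>
     (\<forall>x\<in>hypercube n. mpoly_eval p x = g x)"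

definition cube_degree :: "nat \<Rightarrow> ((nat \<Rightarrow> real) \<Rightarrow> real) \<Rightarrow> nat" where
  "cube_degree n g = total_degree (THE p. is_multilinear_rep n g p)"

definition depends_on :: "nat \<Rightarrow> ((nat \<Rightarrow> real) \<Rightarrow> real) \<Rightarrow> nat \<Rightarrow> bool" where
  "depends_on n g i \<longleftrightarrow> (\<exists>x\<in>hypercube n. \<exists>y\<in>hypercube n.
     (\<forall>j\<in>{1..n} - {i}. x j = y j) \<and> g x \<noteq> g y)"

text \<open>\<^const>\<open>Max\<close> is meaningful here because the set is finite, by the theorem of Nisan and Szegedy
  (its elements are at most \<open>d * 2 ^ (d - 1)\<close> for \<open>d \<ge> 1\<close>); it is nonempty because of constant functions.\<close>

definition gamma :: "nat \<Rightarrow> nat" where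
  "gamma d = Max {card {i\<in>{1..n}. depends_on n g i} | n g.
     g \<in> hypercube n \<rightarrow> {0, 1} \<and> cube_degree n g \<le> d}"


section \<open>Existence and uniqueness of the multilinear representation\<close>

text \<open>These facts show that the definite description in \<^const>\<open>cube_degree\<close> and the least element in
  \<^const>\<open>slice_degree\<close> are well defined. A multilinear polynomial is determined by its coefficients
  at the monomials \<open>sqfree_monom B\<close>, the products of the variables in a finite set \<open>B\<close>.\<close>

definition sqfree_monom :: "nat set \<Rightarrow> monomial" where
  "sqfree_monom B = Abs_poly_mapping (\<lambda>i. if i \<in> B then 1 else 0)"

definition cube_point :: "nat \<Rightarrow> nat set \<Rightarrow> nat \<Rightarrow> real" where
  "cube_point n A = (\<lambda>i\<in>{1..n}. if i \<in> A then 1 else 0)"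

lemma lookup_sqfree_monom:
  "finite B \<Longrightarrow> Poly_Mapping.lookup (sqfree_monom B) i = (if i \<in> B then 1 else 0)"
  unfolding sqfree_monom_def by (subst Abs_poly_mapping_inverse) auto

lemma keys_sqfree_monom: "finite B \<Longrightarrow> Poly_Mapping.keys (sqfree_monom B) = B"
  by (auto simp: in_keys_iff lookup_sqfree_monom split: if_splits)

lemma multilinear_key:
  assumes "multilinear p" "m \<in> Poly_Mapping.keys p"
  shows "m = sqfree_monom (Poly_Mapping.keys m)"
proof (rule poly_mapping_eqI)
  fix i
  have "Poly_Mapping.lookup m i \<le> 1"
    using assms by (auto simp: multilinear_def)
  then show "Poly_Mapping.lookup m i = Poly_Mapping.lookup (sqfree_monom (Poly_Mapping.keys m)) i"
    by (auto simp: lookup_sqfree_monom in_keys_iff)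
qed

lemma cube_point_in [simp]: "cube_point n A \<in> hypercube n"
  by (auto simp: cube_point_def hypercube_def)

lemma hypercube_eq_cube_point:
  assumes "x \<in> hypercube n"
  shows "x = cube_point n {i\<in>{1..n}. x i = 1}"
proof
  fix i
  show "x i = cube_point n {i\<in>{1..n}. x i = 1} i"
  proof (cases "i \<in> {1..n}")
    case True
    then have "x i \<in> {0, 1}" using assms by (auto simp: hypercube_def PiE_iff)
    then show ?thesis using True by (auto simp: cube_point_def)
  next
    case False
    then show ?thesis
      using assms PiE_arb by (fastforce simp: cube_point_def hypercube_def)
  qed
qed

lemma monom_eval_sqfree:
  assumes "B \<subseteq> {1..n}"
  shows "monom_eval (sqfree_monom B) (cube_point n A) = (if B \<subseteq> A then 1 else 0)"
proof -
  have fin: "finite B" using assms finite_subset by blast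
  have "monom_eval (sqfree_monom B) (cube_point n A) = (\<Prod>i\<in>B. if i \<in> A then 1 else 0)"
    unfolding monom_eval_def keys_sqfree_monom[OF fin] using assms
    by (intro prod.cong) (auto simp: lookup_sqfree_monom[OF fin] cube_point_def)
  also have "\<dots> = (if B \<subseteq> A then 1 else 0)"
    using fin by (auto simp: subset_iff)
  finally show ?thesis .
qed

lemma mpoly_eval_multilinear:
  assumes ml: "multilinear p" and vars: "mpoly_vars p \<subseteq> {1..n}" and A: "A \<subseteq> {1..n}"
  shows "mpoly_eval p (cube_point n A) = (\<Sum>B\<in>Pow A. Poly_Mapping.lookup p (sqfree_monom B))"
proof -
  let ?P = "Pow {1..n}"
  have finB: "finite B" if "B \<subseteq> {1..n}" for B using that finite_subset by blast
  have inj: "inj_on sqfree_monom ?P"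
    by (intro inj_onI) (metis PowD finB keys_sqfree_monom)
  have sub: "Poly_Mapping.keys p \<subseteq> sqfree_monom ` ?P"
  proof
    fix m assume m: "m \<in> Poly_Mapping.keys p"
    then have "Poly_Mapping.keys m \<subseteq> {1..n}" using vars by (auto simp: mpoly_vars_def)
    then show "m \<in> sqfree_monom ` ?P" using multilinear_key[OF ml m] by blast
  qed
  have "mpoly_eval p (cube_point n A) =
      (\<Sum>m\<in>sqfree_monom ` ?P. Poly_Mapping.lookup p m * monom_eval m (cube_point n A))"
    unfolding mpoly_eval_def
    by (rule sum.mono_neutral_left) (use sub in \<open>auto simp: in_keys_iff\<close>)
  also have "\<dots> = (\<Sum>B\<in>?P. Poly_Mapping.lookup p (sqfree_monom B) * (if B \<subseteq> A then 1 else 0))"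
    unfolding sum.reindex[OF inj] o_def by (intro sum.cong) (auto simp: monom_eval_sqfree)
  also have "\<dots> = (\<Sum>B\<in>Pow A. Poly_Mapping.lookup p (sqfree_monom B))"
    using A by (intro sum.mono_neutral_cong_right) auto
  finally show ?thesis .
qed

lemma moebius_inversion_exists:
  fixes h :: "nat set \<Rightarrow> real"
  shows "\<exists>c. \<forall>A. finite A \<and> card A \<le> N \<longrightarrow> (\<Sum>B\<in>Pow A. c B) = h A"
proof (induction N)
  case 0
  show ?case by (rule exI[of _ h]) auto
next
  case (Suc N)
  then obtain c where c: "finite A \<Longrightarrow> card A \<le> N \<Longrightarrow> (\<Sum>B\<in>Pow A. c B) = h A" for A by blast
  define c' where "c' A = (if card A \<le> N then c A else h A - (\<Sum>B\<in>Pow A - {A}. c B))" for A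
  have "(\<Sum>B\<in>Pow A. c' B) = h A" if A: "finite A" "card A \<le> Suc N" for A
  proof -
    have small: "c' B = c B" if "B \<in> Pow A - {A}" for B
    proof -
      have "B \<subset> A" using that by auto
      then show ?thesis using A psubset_card_mono[of A B] by (simp add: c'_def)
    qed
    have "(\<Sum>B\<in>Pow A. c' B) = c' A + (\<Sum>B\<in>Pow A - {A}. c' B)"
      using A by (intro sum.remove) auto
    also have "\<dots> = c' A + (\<Sum>B\<in>Pow A - {A}. c B)"
      by (rule arg_cong[where f = "(+) (c' A)"]) (rule sum.cong[OF refl small])
    also have "\<dots> = h A"
    proof (cases "card A \<le> N")
      case True
      have "c A + (\<Sum>B\<in>Pow A - {A}. c B) = (\<Sum>B\<in>Pow A. c B)"
        using A by (intro sum.remove[symmetric]) auto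
      then show ?thesis using True c[of A] A by (simp add: c'_def)
    qed (simp add: c'_def)
    finally show ?thesis .
  qed
  then show ?case by blast
qed

lemma moebius_inversion_unique:
  fixes c c' :: "nat set \<Rightarrow> real"
  assumes "finite S" and eq: "\<And>A. A \<subseteq> S \<Longrightarrow> (\<Sum>B\<in>Pow A. c B) = (\<Sum>B\<in>Pow A. c' B)" and "A \<subseteq> S"
  shows "c A = c' A"
  using \<open>A \<subseteq> S\<close>
proof (induction "card A" arbitrary: A rule: less_induct)
  case less
  have fin: "finite A" using less.prems \<open>finite S\<close> finite_subset by blast
  have "(\<Sum>B\<in>Pow A - {A}. c B) = (\<Sum>B\<in>Pow A - {A}. c' B)"
    using less fin by (intro sum.cong less.hyps psubset_card_mono) auto
  moreover have "(\<Sum>B\<in>Pow A. e B) = e A + (\<Sum>B\<in>Pow A - {A}. e B)" for e :: "nat set \<Rightarrow> real"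
    using fin by (intro sum.remove) auto
  ultimately show ?case using eq[OF less.prems] by simp
qed

lemma ex1_multilinear_rep: "\<exists>!p. is_multilinear_rep n g p"
proof (rule ex_ex1I)
  obtain c where c: "finite A \<Longrightarrow> card A \<le> n \<Longrightarrow> (\<Sum>B\<in>Pow A. c B) = g (cube_point n A)" for A
    using moebius_inversion_exists[of n "\<lambda>A. g (cube_point n A)"] by blast
  define M where "M = sqfree_monom ` Pow {1..n}"
  define p :: real_mpoly where
    "p = Abs_poly_mapping (\<lambda>m. if m \<in> M then c (Poly_Mapping.keys m) else 0)"
  have finB: "finite B" if "B \<subseteq> {1..n}" for B using that finite_subset by blast
  have fin: "finite {m. (if m \<in> M then c (Poly_Mapping.keys m) else 0) \<noteq> 0}"
    by (rule finite_subset[of _ M]) (auto simp: M_def)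
  have lp: "Poly_Mapping.lookup p m = (if m \<in> M then c (Poly_Mapping.keys m) else 0)" for m
    unfolding p_def using fin by (subst Abs_poly_mapping_inverse) auto
  have kp: "Poly_Mapping.keys p \<subseteq> M"
    by (auto simp: in_keys_iff lp split: if_splits)
  have ml: "multilinear p"
    unfolding multilinear_def using kp by (auto simp: M_def lookup_sqfree_monom finB)
  have vars: "mpoly_vars p \<subseteq> {1..n}"
  proof
    fix i assume "i \<in> mpoly_vars p"
    then obtain m where "m \<in> M" "i \<in> Poly_Mapping.keys m" using kp by (auto simp: mpoly_vars_def)
    then show "i \<in> {1..n}" unfolding M_def using keys_sqfree_monom finB by blast
  qed
  have "mpoly_eval p x = g x" if "x \<in> hypercube n" for x
  proof -
    define A where "A = {i\<in>{1..n}. x i = 1}"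
    have x: "x = cube_point n A" using hypercube_eq_cube_point[OF that] by (simp add: A_def)
    have A: "A \<subseteq> {1..n}" by (auto simp: A_def)
    have "mpoly_eval p x = (\<Sum>B\<in>Pow A. c B)"
      unfolding x mpoly_eval_multilinear[OF ml vars A]
    proof (intro sum.cong)
      fix B assume "B \<in> Pow A"
      then have "B \<subseteq> {1..n}" using A by auto
      then show "Poly_Mapping.lookup p (sqfree_monom B) = c B"
        by (simp add: lp M_def keys_sqfree_monom finB)
    qed simp
    also have "\<dots> = g x"
      unfolding x using A finB card_mono[OF _ A] by (intro c) auto
    finally show ?thesis .
  qed
  then show "\<exists>p. is_multilinear_rep n g p" using ml vars by (auto simp: is_multilinear_rep_def)
next
  fix p q assume p: "is_multilinear_rep n g p" and q: "is_multilinear_rep n g q"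
  have coeff: "Poly_Mapping.lookup p (sqfree_monom A) = Poly_Mapping.lookup q (sqfree_monom A)"
    if "A \<subseteq> {1..n}" for A
  proof (rule moebius_inversion_unique[of "{1..n}"])
    fix A assume "A \<subseteq> {1..n}"
    then show "(\<Sum>B\<in>Pow A. Poly_Mapping.lookup p (sqfree_monom B)) =
        (\<Sum>B\<in>Pow A. Poly_Mapping.lookup q (sqfree_monom B))"
      using p q mpoly_eval_multilinear[of p n A] mpoly_eval_multilinear[of q n A]
      by (simp add: is_multilinear_rep_def)
  qed (use that in auto)
  have key: "\<exists>A\<subseteq>{1..n}. m = sqfree_monom A"
    if "is_multilinear_rep n g r" "m \<in> Poly_Mapping.keys r" for r m
  proof -
    have "Poly_Mapping.keys m \<subseteq> {1..n}"
      using that by (auto simp: is_multilinear_rep_def mpoly_vars_def)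
    then show ?thesis
      using that multilinear_key[of r m] by (auto simp: is_multilinear_rep_def)
  qed
  show "p = q"
  proof (rule poly_mapping_eqI)
    fix m
    show "Poly_Mapping.lookup p m = Poly_Mapping.lookup q m"
    proof (cases "m \<in> Poly_Mapping.keys p \<or> m \<in> Poly_Mapping.keys q")
      case True
      then show ?thesis using key[OF p] key[OF q] coeff by blast
    next
      case False
      then show ?thesis by (simp add: in_keys_iff)
    qed
  qed
qed

lemma ex_slice_polynomial:
  "\<exists>p. mpoly_vars p \<subseteq> {1..n} \<and> (\<forall>x\<in>slice n k. mpoly_eval p x = f x)"
  using ex1_multilinear_rep[of n f] by (auto simp: is_multilinear_rep_def slice_def)

end

theory Submission
  imports Defs
begin

text \<open>Matching ones of a point of the slice with zeros and swapping matched pairs embeds a cube into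
  the slice, on which \<open>f\<close> becomes a Boolean function of degree at most \<open>d\<close>; it therefore depends on at
  most \<open>N = 4 d 2^d\<close> pairs, by the argument of Nisan and Szegedy. A matching with the largest number
  of relevant pairs shows that every point has a certificate of at most \<open>c = 2 N\<close> coordinates.
  As \<open>0\<close>- and \<open>1\<close>-certificates conflict, every point of the whole cube, of any weight, agrees on some
  \<open>c (c + 1)\<close> coordinates only with slice points on which \<open>f\<close> is constant. This extends \<open>f\<close> to a Boolean
  function \<open>F\<close> on the cube. A difference of \<open>F\<close> of order \<open>d + 1\<close> involves exponentially many (in \<open>d\<close>)
  coordinates only, so that the remaining ones suffice to realise it inside the slice, where it
  vanishes. Hence \<open>F\<close> has degree at most \<open>d\<close> and depends on at most \<open>\<gamma>(d)\<close> coordinates.\<close>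

section \<open>Degree of functions on a cube\<close>

text \<open>A real function on the cube \<open>Pow U\<close> has degree at most \<open>d\<close> iff all its differences of order
  \<open>d + 1\<close> vanish.\<close>

definition deg_le :: "'a set \<Rightarrow> nat \<Rightarrow> ('a set \<Rightarrow> real) \<Rightarrow> bool" where
  "deg_le U d h \<longleftrightarrow> (\<forall>S R. S \<subseteq> U \<and> R \<subseteq> U - S \<and> card S = Suc d \<longrightarrow>
     (\<Sum>B\<in>Pow S. (-1) ^ card B * h (B \<union> R)) = 0)"

lemma deg_leD:
  "deg_le U d h \<Longrightarrow> S \<subseteq> U \<Longrightarrow> R \<subseteq> U - S \<Longrightarrow> card S = Suc d \<Longrightarrow>
    (\<Sum>B\<in>Pow S. (-1) ^ card B * h (B \<union> R)) = 0"
  unfolding deg_le_def by blast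

section \<open>Alternating sums over subsets\<close>

lemma sum_Pow_insert:
  fixes g :: "'a set \<Rightarrow> real"
  assumes "finite U" "u \<notin> U"
  shows "(\<Sum>B\<in>Pow (insert u U). g B) = (\<Sum>B\<in>Pow U. g B) + (\<Sum>B\<in>Pow U. g (insert u B))"
proof -
  have "inj_on (insert u) (Pow U)"
    using assms(2) by (intro inj_onI) (metis PowD insert_ident subsetD)
  moreover have "Pow U \<inter> insert u ` Pow U = {}" using assms(2) by auto
  ultimately show ?thesis
    unfolding Pow_insert using assms(1) by (subst sum.union_disjoint) (auto simp: sum.reindex)
qed

lemma alternating_sum_insert:
  fixes g :: "'a set \<Rightarrow> real"
  assumes "finite S" "u \<notin> S"
  shows "(\<Sum>B\<in>Pow (insert u S). (-1) ^ card B * g B) =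
    (\<Sum>B\<in>Pow S. (-1) ^ card B * (g B - g (insert u B)))"
proof -
  have "(-1 :: real) ^ card (insert u B) = - ((-1) ^ card B)" if "B \<in> Pow S" for B
  proof -
    have "finite B" "u \<notin> B" using that assms finite_subset by auto
    then show ?thesis by simp
  qed
  then show ?thesis
    unfolding sum_Pow_insert[OF assms] right_diff_distrib sum_subtractf by (simp add: sum_negf)
qed

text \<open>The terms of \<open>B\<close> and \<open>insert i B\<close> have opposite signs and
  cancel in pairs.\<close>

lemma alternating_sum_cancel:
  fixes g :: "'a set \<Rightarrow> real"
  assumes "finite S" "i \<in> S" "\<And>B. B \<subseteq> S - {i} \<Longrightarrow> g (insert i B) = g B"
  shows "(\<Sum>B\<in>Pow S. (-1) ^ card B * g B) = 0"
proof -
  have "(\<Sum>B\<in>Pow (insert i (S - {i})). (-1) ^ card B * g B) = 0"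
    by (subst alternating_sum_insert) (use assms in \<open>auto intro!: sum.neutral\<close>)
  then show ?thesis using assms(2) by (simp add: insert_absorb)
qed

text \<open>Moebius inversion on subsets. After swapping the sums, the signs over all
  \<open>B\<close> containing \<open>D\<close> cancel along any element of \<open>A - D\<close>, so
  only \<open>D = A\<close> survives.\<close>

lemma alternating_sum_moebius:
  fixes c :: "'a set \<Rightarrow> real"
  assumes "finite A"
  shows "(\<Sum>B\<in>Pow A. (-1) ^ card B * (\<Sum>D\<in>Pow B. c D)) = (-1) ^ card A * c A"
proof -
  let ?I = "\<lambda>D. \<Sum>B\<in>Pow A. (-1) ^ card B * (if D \<subseteq> B then 1 else 0 :: real)"
  have "(\<Sum>D\<in>Pow B. c D) = (\<Sum>D\<in>Pow A. c D * (if D \<subseteq> B then 1 else 0))" if "B \<in> Pow A" for B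
    using assms that by (intro sum.mono_neutral_cong_left) auto
  then have "(\<Sum>B\<in>Pow A. (-1) ^ card B * (\<Sum>D\<in>Pow B. c D)) =
      (\<Sum>B\<in>Pow A. \<Sum>D\<in>Pow A. c D * ((-1) ^ card B * (if D \<subseteq> B then 1 else 0)))"
    by (intro sum.cong) (auto simp: sum_distrib_left ac_simps)
  also have "\<dots> = (\<Sum>D\<in>Pow A. c D * ?I D)"
    by (subst sum.swap) (simp add: sum_distrib_left)
  also have "\<dots> = (\<Sum>D\<in>{A}. c D * ?I D)"
  proof (rule sum.mono_neutral_right)
    show "\<forall>D\<in>Pow A - {A}. c D * ?I D = 0"
    proof
      fix D assume "D \<in> Pow A - {A}"
      then obtain i where i: "i \<in> A" "i \<notin> D" by blast
      have "?I D = 0"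
        using assms i by (intro alternating_sum_cancel[of _ i]) (auto simp: subset_insert)
      then show "c D * ?I D = 0" by simp
    qed
  qed (use assms in auto)
  also have "?I A = (\<Sum>B\<in>{A}. (-1) ^ card B * (if A \<subseteq> B then 1 else 0))"
    using assms by (intro sum.mono_neutral_right) auto
  then have "(\<Sum>D\<in>{A}. c D * ?I D) = (-1) ^ card A * c A" by simp
  finally show ?thesis .
qed

section \<open>Closure properties of bounded degree\<close>

lemma deg_le_add: "deg_le U d g \<Longrightarrow> deg_le U d h \<Longrightarrow> deg_le U d (\<lambda>B. g B + h B)"
  unfolding deg_le_def by (auto simp: distrib_left sum.distrib)

lemma deg_le_diff: "deg_le U d g \<Longrightarrow> deg_le U d h \<Longrightarrow> deg_le U d (\<lambda>B. g B - h B)"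
  unfolding deg_le_def by (auto simp: right_diff_distrib sum_subtractf)

text \<open>A difference of order \<open>d + 2\<close> is the difference of two of order
  \<open>d + 1\<close>, with base points \<open>R\<close> and \<open>insert u R\<close>.\<close>

lemma deg_le_Suc:
  assumes "finite U" "deg_le U d h"
  shows "deg_le U (Suc d) h"
  unfolding deg_le_def
proof (intro allI impI, elim conjE)
  fix S R assume SR: "S \<subseteq> U" "R \<subseteq> U - S" "card S = Suc (Suc d)"
  then obtain u S' where S': "S = insert u S'" "u \<notin> S'" "card S' = Suc d"
    by (metis card_Suc_eq)
  have fin: "finite S'" using S' by (simp add: card_ge_0_finite)
  have "(\<Sum>B\<in>Pow S'. (-1) ^ card B * h (B \<union> R)) = 0"
    "(\<Sum>B\<in>Pow S'. (-1) ^ card B * h (B \<union> insert u R)) = 0"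
    by (rule deg_leD[OF assms(2)]; use SR S' in auto)+
  then show "(\<Sum>B\<in>Pow S. (-1) ^ card B * h (B \<union> R)) = 0"
    unfolding S'(1) alternating_sum_insert[OF fin S'(2)]
    by (simp add: right_diff_distrib sum_subtractf)
qed

lemma deg_le_mono:
  assumes "finite U" "deg_le U d h" "d \<le> e"
  shows "deg_le U e h"
  using assms(3) by (induction e rule: dec_induct) (auto intro: assms deg_le_Suc)

lemma deg_le_restrict0: "deg_le (insert u U) d h \<Longrightarrow> u \<notin> U \<Longrightarrow> deg_le U d h"
  unfolding deg_le_def by blast

lemma deg_le_restrict1:
  assumes "deg_le (insert u U) d h" "u \<notin> U"
  shows "deg_le U d (\<lambda>B. h (insert u B))"
  unfolding deg_le_def
proof (intro allI impI)
  fix S R assume SR: "S \<subseteq> U \<and> R \<subseteq> U - S \<and> card S = Suc d"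
  have "(\<Sum>B\<in>Pow S. (-1) ^ card B * h (B \<union> insert u R)) = 0"
    by (rule deg_leD[OF assms(1)]) (use SR assms(2) in auto)
  then show "(\<Sum>B\<in>Pow S. (-1) ^ card B * h (insert u (B \<union> R))) = 0" by simp
qed

lemma deg_le_derivative:
  assumes "deg_le (insert u U) (Suc d) h" "u \<notin> U" "finite U"
  shows "deg_le U d (\<lambda>B. h B - h (insert u B))"
  unfolding deg_le_def
proof (intro allI impI)
  fix S R assume SR: "S \<subseteq> U \<and> R \<subseteq> U - S \<and> card S = Suc d"
  then have fin: "finite S" "u \<notin> S" using assms finite_subset by auto
  have "(\<Sum>B\<in>Pow (insert u S). (-1) ^ card B * h (B \<union> R)) = 0"
    by (rule deg_leD[OF assms(1)]) (use SR assms(2) fin in auto)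
  then show "(\<Sum>B\<in>Pow S. (-1) ^ card B * (h (B \<union> R) - h (insert u (B \<union> R)))) = 0"
    by (simp add: alternating_sum_insert[OF fin])
qed

lemma deg_le_0D:
  assumes "deg_le (insert u U) 0 h" "u \<notin> U" "B \<subseteq> U"
  shows "h (insert u B) = h B"
  using deg_leD[OF assms(1), of "{u}" B] assms(2,3) by (auto simp: Pow_insert insert_Diff_if)

section \<open>The number of relevant coordinates\<close>

lemma card_Pow_filter_insert:
  assumes "finite U" "u \<notin> U"
  shows "card {B\<in>Pow (insert u U). P B} =
    card {B\<in>Pow U. P B} + card {B\<in>Pow U. P (insert u B)}"
proof -
  have "real (card {B\<in>Pow S. Q B}) = (\<Sum>B\<in>Pow S. if Q B then 1 else 0)"
    if "finite S" for Q and S :: "'a set"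
    using that by (simp add: sum.If_cases Int_def)
  then have "real (card {B\<in>Pow (insert u U). P B}) =
      real (card {B\<in>Pow U. P B}) + real (card {B\<in>Pow U. P (insert u B)})"
    using assms by (simp add: sum_Pow_insert)
  then show ?thesis by linarith
qed

text \<open>The analogue of Schwartz-Zippel: a nonzero function of degree at most \<open>d\<close>
  is nonzero on a fraction of at least \<open>2 ^ -d\<close> of the cube. Split along
  \<open>u\<close>. If both halves are nonzero, induction applies to each. If one vanishes, the
  other is the derivative up to sign, and its lower degree makes up for the lost factor 2.\<close>

lemma deg_le_nonzero_count:
  assumes "finite U" "deg_le U d h" "B \<subseteq> U" "h B \<noteq> 0"
  shows "2 ^ card U \<le> 2 ^ d * card {B\<in>Pow U. h B \<noteq> 0}"
  using assms
proof (induction U arbitrary: d h B rule: finite_induct)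
  case empty
  then have "{B\<in>Pow {}. h B \<noteq> 0} = {{}}" by auto
  then show ?case by simp
next
  case (insert u U)
  let ?h1 = "\<lambda>B. h (insert u B)"
  let ?N0 = "card {B\<in>Pow U. h B \<noteq> 0}" and ?N1 = "card {B\<in>Pow U. h (insert u B) \<noteq> 0}"
  note split = card_Pow_filter_insert[OF insert.hyps(1,2), of "\<lambda>B. h B \<noteq> 0"]
  have d0: "deg_le U d h" and d1: "deg_le U d ?h1"
    using insert.prems insert.hyps by (auto intro: deg_le_restrict0 deg_le_restrict1)
  consider (both) "\<exists>B\<subseteq>U. h B \<noteq> 0" "\<exists>B\<subseteq>U. ?h1 B \<noteq> 0"
    | (zero1) "\<exists>B\<subseteq>U. h B \<noteq> 0" "\<forall>B\<subseteq>U. ?h1 B = 0"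
    | (zero0) "\<exists>B\<subseteq>U. ?h1 B \<noteq> 0" "\<forall>B\<subseteq>U. h B = 0"
  proof -
    have "h (B - {u}) \<noteq> 0 \<or> ?h1 (B - {u}) \<noteq> 0"
      using insert.prems(3) by (cases "u \<in> B") (auto simp: insert_absorb)
    moreover have "B - {u} \<subseteq> U" using insert.prems(2) by auto
    ultimately show ?thesis using that by blast
  qed
  then show ?case
  proof cases
    case both
    have "2 ^ card U \<le> 2 ^ d * ?N0" using both(1) insert.IH[OF d0] by blast
    moreover have "2 ^ card U \<le> 2 ^ d * ?N1" using both(2) insert.IH[OF d1] by blast
    ultimately show ?thesis unfolding split using insert.hyps by (simp add: distrib_left)
  next
    case zero1
    \<comment> \<open>Degree 0 would make the two halves equal, although exactly one of them
      vanishes.\<close>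
    obtain e where d: "d = Suc e"
    proof (cases d)
      case 0
      then show ?thesis using zero1 deg_le_0D[of u U h] insert.prems insert.hyps by metis
    qed (use that in blast)
    have "deg_le U e (\<lambda>B. h B - ?h1 B)"
      using insert.prems insert.hyps d by (intro deg_le_derivative) auto
    then have "2 ^ card U \<le> 2 ^ e * card {B\<in>Pow U. h B - ?h1 B \<noteq> 0}"
      using insert.IH[of e "\<lambda>B. h B - ?h1 B"] zero1 by force
    also have "{B\<in>Pow U. h B - ?h1 B \<noteq> 0} = {B\<in>Pow U. h B \<noteq> 0}" using zero1 by auto
    finally show ?thesis unfolding split using insert.hyps d by (simp add: distrib_left)
  next
    case zero0
    obtain e where d: "d = Suc e"
    proof (cases d)
      case 0
      then show ?thesis using zero0 deg_le_0D[of u U h] insert.prems insert.hyps by metis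
    qed (use that in blast)
    have "deg_le U e (\<lambda>B. h B - ?h1 B)"
      using insert.prems insert.hyps d by (intro deg_le_derivative) auto
    then have "2 ^ card U \<le> 2 ^ e * card {B\<in>Pow U. h B - ?h1 B \<noteq> 0}"
      using insert.IH[of e "\<lambda>B. h B - ?h1 B"] zero0 by force
    also have "{B\<in>Pow U. h B - ?h1 B \<noteq> 0} = {B\<in>Pow U. ?h1 B \<noteq> 0}" using zero0 by auto
    finally show ?thesis unfolding split using insert.hyps d by (simp add: distrib_left)
  qed
qed

text \<open>The total influence without normalisation: each edge of the cube is counted once, so for
  Boolean \<open>h\<close> this is the number of edges along which \<open>h\<close> changes.\<close>

definition energy :: "'a set \<Rightarrow> ('a set \<Rightarrow> real) \<Rightarrow> real" where
  "energy U h = (\<Sum>i\<in>U. \<Sum>B\<in>Pow (U - {i}). (h (insert i B) - h B)\<^sup>2)"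

lemma energy_insert:
  assumes "finite U" "u \<notin> U"
  shows "energy (insert u U) h =
    energy U h + energy U (\<lambda>B. h (insert u B)) + (\<Sum>B\<in>Pow U. (h B - h (insert u B))\<^sup>2)"
proof -
  have "(\<Sum>B\<in>Pow (insert u U - {i}). (h (insert i B) - h B)\<^sup>2) =
      (\<Sum>B\<in>Pow (U - {i}). (h (insert i B) - h B)\<^sup>2) +
      (\<Sum>B\<in>Pow (U - {i}). (h (insert u (insert i B)) - h (insert u B))\<^sup>2)" if "i \<in> U" for i
  proof -
    have "insert u U - {i} = insert u (U - {i})" using that assms by auto
    then show ?thesis using assms by (simp add: sum_Pow_insert insert_commute)
  qed
  moreover have "insert u U - {u} = U" using assms by auto
  ultimately show ?thesis
    unfolding energy_def using assms by (simp add: sum.distrib power2_commute)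
qed

lemma energy_parallelogram:
  "energy U (\<lambda>B. g B + h B) + energy U (\<lambda>B. g B - h B) = 2 * energy U g + 2 * energy U h"
proof -
  have "(g B' + h B' - (g B + h B))\<^sup>2 + (g B' - h B' - (g B - h B))\<^sup>2 =
      2 * (g B' - g B)\<^sup>2 + 2 * (h B' - h B)\<^sup>2" for B B'
    by (simp add: power2_eq_square algebra_simps)
  then show ?thesis
    unfolding energy_def by (simp add: sum.distrib[symmetric] sum_distrib_left)
qed

text \<open>Splitting off a coordinate, \<open>h\<close> is described by its average, of degree at most \<open>d\<close>, and its
  difference, of degree at most \<open>d - 1\<close>; this replaces the Fourier expansion.\<close>

lemma energy_le:
  assumes "finite U" "deg_le U d h"
  shows "energy U h \<le> 2 * real d * (\<Sum>B\<in>Pow U. (h B)\<^sup>2)"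
  using assms
proof (induction U arbitrary: d h rule: finite_induct)
  case empty
  then show ?case by (simp add: energy_def)
next
  case (insert u U)
  define a where "a = (\<lambda>B. h B + h (insert u B))"
  define b where "b = (\<lambda>B. h B - h (insert u B))"
  let ?A = "\<Sum>B\<in>Pow U. (a B)\<^sup>2" and ?B = "\<Sum>B\<in>Pow U. (b B)\<^sup>2"
  have "deg_le U d a"
    unfolding a_def using insert.prems insert.hyps
    by (metis deg_le_add deg_le_restrict0 deg_le_restrict1)
  then have Ea: "energy U a \<le> 2 * (real d * ?A)" using insert.IH by (simp add: mult.assoc)
  \<comment> \<open>The derivative \<open>b\<close> has degree at most \<open>d - 1\<close>. This
    saves exactly \<open>2 * ?B\<close>, which pays for the edges in direction
    \<open>u\<close>.\<close>
  have Eb: "energy U b + 2 * ?B \<le> 2 * (real d * ?B)"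
  proof (cases d)
    case 0
    then have "b B = 0" if "B \<subseteq> U" for B
      unfolding b_def using deg_le_0D[of u U h B] that insert.prems insert.hyps by auto
    moreover from this have "b (insert i B) = 0" "b B = 0" if "i \<in> U" "B \<subseteq> U - {i}" for i B
      using that by (metis insert_subset subset_Diff_insert Diff_empty)+
    ultimately have "?B = 0" "energy U b = 0"
      unfolding energy_def by (auto intro!: sum.neutral)
    then show ?thesis by simp
  next
    case (Suc e)
    then have "deg_le U e b"
      unfolding b_def using insert.prems insert.hyps by (intro deg_le_derivative) auto
    then show ?thesis using insert.IH[of e b] Suc by (simp add: algebra_simps)
  qed
  have E: "energy (insert u U) h = (energy U a + energy U b) / 2 + ?B"
    unfolding energy_insert[OF insert.hyps] a_def b_def energy_parallelogram by simp
  have eq: "(\<Sum>B\<in>Pow (insert u U). (h B)\<^sup>2) = (?A + ?B) / 2"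
  proof -
    have "(h B)\<^sup>2 + (h (insert u B))\<^sup>2 = ((a B)\<^sup>2 + (b B)\<^sup>2) / 2" for B
      by (simp add: a_def b_def power2_eq_square field_simps)
    then show ?thesis
      unfolding sum_Pow_insert[OF insert.hyps] sum.distrib[symmetric] sum_divide_distrib by (rule sum.cong[OF refl])
  qed
  show ?case using Ea Eb unfolding E eq by (simp add: distrib_left mult.assoc add_divide_distrib)
qed

definition relevant :: "'a set \<Rightarrow> ('a set \<Rightarrow> real) \<Rightarrow> 'a set" where
  "relevant U h = {i\<in>U. \<exists>B\<subseteq>U. h (insert i B) \<noteq> h (B - {i})}"

lemma relevantI: "i \<in> U \<Longrightarrow> B \<subseteq> U \<Longrightarrow> h (insert i B) \<noteq> h (B - {i}) \<Longrightarrow> i \<in> relevant U h"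
  unfolding relevant_def by blast

text \<open>For relevant \<open>i\<close> the derivative is a nonzero function of degree at most
  \<open>d\<close> on the half cube \<open>Pow (U - {i})\<close>, so at least
  \<open>2 ^ card U / (2 * 2 ^ d)\<close> edges in direction \<open>i\<close> change the value. By
  \<open>energy_le\<close> there are at most \<open>2 * d * 2 ^ card U\<close> such edges in all
  directions together.\<close>

lemma card_relevant_le:
  assumes "finite U" "deg_le U d h" and bool: "\<And>B. B \<subseteq> U \<Longrightarrow> h B \<in> {0, 1}"
  shows "card (relevant U h) \<le> 4 * d * 2 ^ d"
proof -
  let ?R = "relevant U h"
  have sub: "?R \<subseteq> U" by (auto simp: relevant_def)
  then have fin: "finite ?R" using assms finite_subset by blast
  have infl: "2 ^ card U \<le> 2 * 2 ^ d * (\<Sum>B\<in>Pow (U - {i}). (h (insert i B) - h B)\<^sup>2)"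
    if i: "i \<in> ?R" for i
  proof -
    let ?D = "\<lambda>B. h B - h (insert i B)"
    obtain B where B: "i \<in> U" "B \<subseteq> U" "h (insert i B) \<noteq> h (B - {i})"
      using i by (auto simp: relevant_def)
    have ins: "insert i (U - {i}) = U" using B by auto
    have U: "deg_le (insert i (U - {i})) d h" using assms ins by simp
    have "deg_le (U - {i}) d ?D"
      by (intro deg_le_diff deg_le_restrict0[OF U] deg_le_restrict1[OF U]) auto
    then have "2 ^ card (U - {i}) \<le> 2 ^ d * card {B\<in>Pow (U - {i}). ?D B \<noteq> 0}"
      using assms B by (intro deg_le_nonzero_count[where B = "B - {i}"]) auto
    then have *: "2 ^ card U \<le> 2 * 2 ^ d * card {B\<in>Pow (U - {i}). ?D B \<noteq> 0}"
      using card.remove[OF assms(1) B(1)] by simp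
    have "(h (insert i B) - h B)\<^sup>2 = (if ?D B \<noteq> 0 then 1 else 0)" if "B \<in> Pow (U - {i})" for B
    proof -
      have "B \<subseteq> U" "insert i B \<subseteq> U" using that B by auto
      then have "h B \<in> {0, 1}" "h (insert i B) \<in> {0, 1}" by (simp_all only: bool)
      then show ?thesis by auto
    qed
    then have "(\<Sum>B\<in>Pow (U - {i}). (h (insert i B) - h B)\<^sup>2) =
        (\<Sum>B\<in>Pow (U - {i}). if ?D B \<noteq> 0 then 1 else 0)"
      by (rule sum.cong[OF refl])
    also have "\<dots> = real (card {B\<in>Pow (U - {i}). ?D B \<noteq> 0})"
      using assms by (simp add: sum.If_cases Int_def)
    finally have "(\<Sum>B\<in>Pow (U - {i}). (h (insert i B) - h B)\<^sup>2) =
      real (card {B\<in>Pow (U - {i}). ?D B \<noteq> 0})" .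
    moreover have "real (2 ^ card U) \<le> real (2 * 2 ^ d * card {B\<in>Pow (U - {i}). ?D B \<noteq> 0})"
      using * by (rule of_nat_mono)
    ultimately show ?thesis by simp
  qed
  have "real (card ?R) * 2 ^ card U \<le>
      (\<Sum>i\<in>?R. 2 * 2 ^ d * (\<Sum>B\<in>Pow (U - {i}). (h (insert i B) - h B)\<^sup>2))"
    using sum_mono[OF infl, of ?R "\<lambda>i. i"] by simp
  also have "\<dots> \<le> (\<Sum>i\<in>U. 2 * 2 ^ d * (\<Sum>B\<in>Pow (U - {i}). (h (insert i B) - h B)\<^sup>2))"
    by (rule sum_mono2) (auto simp: assms sub sum_nonneg)
  also have "\<dots> = 2 * 2 ^ d * energy U h"
    unfolding energy_def by (simp add: sum_distrib_left)
  also have "\<dots> \<le> 2 * 2 ^ d * (2 * real d * (\<Sum>B\<in>Pow U. (h B)\<^sup>2))"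
    by (intro mult_left_mono energy_le assms) auto
  also have "\<dots> \<le> 2 * 2 ^ d * (2 * real d * 2 ^ card U)"
  proof -
    have "(\<Sum>B\<in>Pow U. (h B)\<^sup>2) \<le> (\<Sum>B\<in>Pow U. 1)"
    proof (rule sum_mono)
      fix B assume "B \<in> Pow U"
      then show "(h B)\<^sup>2 \<le> 1" using bool[of B] by auto
    qed
    also have "\<dots> = 2 ^ card U" using assms by (simp add: card_Pow)
    finally show ?thesis by (intro mult_left_mono) auto
  qed
  finally have "real (card ?R) \<le> 4 * real d * 2 ^ d" by (simp add: algebra_simps)
  then have "real (card ?R) \<le> real (4 * d * 2 ^ d)" by simp
  then show ?thesis by (simp only: of_nat_le_iff)
qed

text \<open>Irrelevant elements can be deleted one at a time without changing the value.\<close>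

lemma relevant_determines:
  assumes "finite U" "B \<subseteq> U" "C \<subseteq> U" "B \<inter> relevant U h = C \<inter> relevant U h"
  shows "h B = h C"
proof -
  have shrink: "h B = h (B \<inter> relevant U h)" if "B \<subseteq> U" for B
  proof -
    have "finite D \<Longrightarrow> D \<subseteq> B - relevant U h \<Longrightarrow> h (B - D) = h B" for D
    proof (induction D rule: finite_induct)
      case (insert i D)
      then have "i \<notin> relevant U h" "i \<in> U" "B - D \<subseteq> U" using that by auto
      then have "h (insert i (B - D)) = h (B - D - {i})" by (auto simp: relevant_def)
      moreover have "insert i (B - D) = B - D" "B - insert i D = B - D - {i}"
        using insert by auto
      ultimately show ?case using insert by auto
    qed simp
    from this[of "B - relevant U h"] show ?thesis
      using assms(1) that finite_subset by (metis Diff_Diff_Int finite_Diff order_refl)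
  qed
  show ?thesis using shrink[OF assms(2)] shrink[OF assms(3)] assms(4) by simp
qed

section \<open>Certificates on a layer\<close>

definition layer :: "'a set \<Rightarrow> nat \<Rightarrow> 'a set set" where
  "layer V k = {X. X \<subseteq> V \<and> card X = k}"

text \<open>Setting \<open>x (j i) = 1 - x i\<close> for \<open>i \<in> T\<close> and fixing the other coordinates embeds the cube \<open>Pow T\<close>
  into the layer; the degree of a function on the layer only matters through these cubes.\<close>

definition slice_deg_le :: "'a set \<Rightarrow> nat \<Rightarrow> nat \<Rightarrow> ('a set \<Rightarrow> real) \<Rightarrow> bool" where
  "slice_deg_le V k d \<phi> \<longleftrightarrow> (\<forall>T j W. T \<subseteq> V \<and> inj_on j T \<and> j ` T \<subseteq> V - T \<and>
     W \<subseteq> V - T - j ` T \<and> card T + card W = k \<longrightarrow>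
     deg_le T d (\<lambda>B. \<phi> (B \<union> j ` (T - B) \<union> W)))"

text \<open>\<open>Y\<close> need not lie in the layer, so that points of any weight can have
  certificates; only values at layer points are compared.\<close>

definition certifies :: "'a set \<Rightarrow> nat \<Rightarrow> ('a set \<Rightarrow> real) \<Rightarrow> 'a set \<Rightarrow> 'a set \<Rightarrow> bool" where
  "certifies V k \<phi> Y Q \<longleftrightarrow> Q \<subseteq> V \<and>
     (\<forall>X\<in>layer V k. \<forall>X'\<in>layer V k. X \<inter> Q = Y \<inter> Q \<and> X' \<inter> Q = Y \<inter> Q \<longrightarrow> \<phi> X = \<phi> X')"

text \<open>The pattern \<open>Y \<inter> Q\<close> is filled up to \<open>k\<close> elements
  outside \<open>Q\<close>; the two bounds leave enough room. This ensures that small certificates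
  are never vacuous.\<close>

lemma layer_extension:
  assumes "finite V" "Q \<subseteq> V" "card Q \<le> k" "k + card Q \<le> card V"
  shows "\<exists>X\<in>layer V k. X \<inter> Q = Y \<inter> Q"
proof -
  have fin: "finite Q" using assms finite_subset by blast
  then have le: "card (Y \<inter> Q) \<le> card Q" by (intro card_mono) auto
  have "card (V - Q) = card V - card Q" using assms fin by (intro card_Diff_subset)
  then have "k - card (Y \<inter> Q) \<le> card (V - Q)" using assms by linarith
  then obtain W where W: "W \<subseteq> V - Q" "card W = k - card (Y \<inter> Q)" "finite W"
    by (metis obtain_subset_with_card_n)
  have "card ((Y \<inter> Q) \<union> W) = card (Y \<inter> Q) + card W"
    using fin W by (intro card_Un_disjoint) auto
  then have "(Y \<inter> Q) \<union> W \<in> layer V k" using W assms le by (auto simp: layer_def)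
  moreover have "((Y \<inter> Q) \<union> W) \<inter> Q = Y \<inter> Q" using W by auto
  ultimately show ?thesis by blast
qed

text \<open>Each pair contributes exactly one of its two elements, whatever \<open>B\<close>
  is.\<close>

lemma pairing_in_layer:
  assumes "finite V" "T \<subseteq> V" "inj_on j T" "j ` T \<subseteq> V - T" "W \<subseteq> V - T - j ` T"
    "card T + card W = k" "B \<subseteq> T"
  shows "B \<union> j ` (T - B) \<union> W \<in> layer V k"
proof -
  have fin: "finite T" "finite B" "finite W"
    using assms by (metis Diff_subset finite_subset subset_trans)+
  have "card (B \<union> j ` (T - B) \<union> W) = card (B \<union> j ` (T - B)) + card W"
    using assms fin by (intro card_Un_disjoint) auto
  also have "card (B \<union> j ` (T - B)) = card B + card (j ` (T - B))"
    using assms fin by (intro card_Un_disjoint) auto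
  also have "card (j ` (T - B)) = card (T - B)"
    using assms by (intro card_image) (auto intro: inj_on_subset)
  also have "\<dots> = card T - card B" using assms fin by (intro card_Diff_subset) auto
  finally have "card (B \<union> j ` (T - B) \<union> W) = k"
    using assms card_mono[OF fin(1) assms(7)] by linarith
  then show ?thesis using assms by (auto simp: layer_def)
qed

text \<open>Swapping matched elements embeds a cube into the layer, with \<open>X\<close> as its top.\<close>

definition pairing :: "'a set \<Rightarrow> 'a set \<Rightarrow> 'a set \<Rightarrow> ('a \<Rightarrow> 'a) \<Rightarrow> bool" where
  "pairing V X T j \<longleftrightarrow> T \<subseteq> X \<and> inj_on j T \<and> j ` T \<subseteq> V - X"

text \<open>The pairs in \<open>B\<close> are left alone and those in \<open>T - B\<close> are
  swapped, so \<open>B = T\<close> gives \<open>X\<close> itself.\<close>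

definition pairing_fun :: "('a set \<Rightarrow> real) \<Rightarrow> 'a set \<Rightarrow> 'a set \<Rightarrow> ('a \<Rightarrow> 'a) \<Rightarrow> 'a set \<Rightarrow> real" where
  "pairing_fun \<phi> X T j B = \<phi> (B \<union> j ` (T - B) \<union> (X - T))"

lemma card_relevant_pairing:
  assumes "finite V" "X \<in> layer V k" "slice_deg_le V k d \<phi>" "\<phi> \<in> layer V k \<rightarrow> {0, 1}"
    "pairing V X T j"
  shows "card (relevant T (pairing_fun \<phi> X T j)) \<le> 4 * d * 2 ^ d"
proof (rule card_relevant_le)
  have X: "X \<subseteq> V" "card X = k" using assms by (auto simp: layer_def)
  have T: "T \<subseteq> X" "inj_on j T" "j ` T \<subseteq> V - X" using assms by (auto simp: pairing_def)
  have fin: "finite X" using X assms finite_subset by blast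
  then show "finite T" using T finite_subset by blast
  then have "card (X - T) = k - card T" using X T by (simp add: card_Diff_subset)
  then have card: "card T + card (X - T) = k" using card_mono[OF fin T(1)] X by linarith
  have sub: "T \<subseteq> V" "j ` T \<subseteq> V - T" "X - T \<subseteq> V - T - j ` T" using X T by auto
  show "deg_le T d (pairing_fun \<phi> X T j)"
    using assms(3) T(2) sub card unfolding slice_deg_le_def pairing_fun_def[abs_def] by blast
  show "pairing_fun \<phi> X T j B \<in> {0, 1}" if "B \<subseteq> T" for B
    unfolding pairing_fun_def using assms(4)
    by (rule funcset_mem) (rule pairing_in_layer[OF assms(1) sub(1) T(2) sub(2,3) card that])
qed

text \<open>Dropping the irrelevant pairs amounts to never swapping them, which affects no value
  that relevance of the others depends on. A pairing can thus be assumed to have relevant pairs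
  only.\<close>

lemma relevant_pairing_restrict:
  fixes \<phi> :: "'a set \<Rightarrow> real"
  assumes "finite X" "pairing V X T j"
  defines "R \<equiv> relevant T (pairing_fun \<phi> X T j)"
  shows "pairing V X R j" "relevant R (pairing_fun \<phi> X R j) = R"
proof -
  let ?h = "pairing_fun \<phi> X T j"
  have T: "T \<subseteq> X" "inj_on j T" "j ` T \<subseteq> V - X" using assms by (auto simp: pairing_def)
  have fin: "finite T" using T assms finite_subset by blast
  have R: "R \<subseteq> T" by (auto simp: R_def relevant_def)
  show "pairing V X R j" using T R by (auto simp: pairing_def intro: inj_on_subset)
  have eq: "pairing_fun \<phi> X R j B = ?h (B \<union> (T - R))" if "B \<subseteq> R" for B
  proof -
    have "B \<union> (T - R) \<union> j ` (T - (B \<union> (T - R))) \<union> (X - T) = B \<union> j ` (R - B) \<union> (X - R)"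
    proof -
      have "T - (B \<union> (T - R)) = R - B" using R that by auto
      then show ?thesis using R T that by auto
    qed
    then show ?thesis by (simp add: pairing_fun_def)
  qed
  show "relevant R (pairing_fun \<phi> X R j) = R"
  proof
    show "R \<subseteq> relevant R (pairing_fun \<phi> X R j)"
    proof
      fix i assume i: "i \<in> R"
      then obtain B where B: "B \<subseteq> T" "?h (insert i B) \<noteq> ?h (B - {i})"
        by (auto simp: R_def relevant_def)
      have "pairing_fun \<phi> X R j (insert i (B \<inter> R)) = ?h (insert i (B \<inter> R) \<union> (T - R))"
        using i by (intro eq) auto
      also have "\<dots> = ?h (insert i B)"
        by (rule relevant_determines[OF fin]) (use R B i in \<open>auto simp: R_def[symmetric]\<close>)
      finally have 1: "pairing_fun \<phi> X R j (insert i (B \<inter> R)) = ?h (insert i B)" .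
      have "pairing_fun \<phi> X R j (B \<inter> R - {i}) = ?h (B \<inter> R - {i} \<union> (T - R))"
        by (intro eq) auto
      also have "\<dots> = ?h (B - {i})"
        by (rule relevant_determines[OF fin]) (use R B i in \<open>auto simp: R_def[symmetric]\<close>)
      finally show "i \<in> relevant R (pairing_fun \<phi> X R j)"
        using 1 B i by (intro relevantI[of _ _ "B \<inter> R"]) auto
    qed
  qed (auto simp: relevant_def)
qed

text \<open>Take a pairing at \<open>X\<close> with the largest number of relevant pairs. Any two points of the layer that
  agree with \<open>X\<close> on these pairs differ by swaps that extend the pairing, and by maximality none
  of the additional pairs is relevant.\<close>

lemma layer_certificate:
  assumes "finite V" "X \<in> layer V k" "slice_deg_le V k d \<phi>" "\<phi> \<in> layer V k \<rightarrow> {0, 1}"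
  shows "\<exists>Q. certifies V k \<phi> X Q \<and> card Q \<le> 8 * d * 2 ^ d"
proof -
  define rel where "rel = (\<lambda>(T, j). relevant T (pairing_fun \<phi> X T j))"
  have X: "X \<subseteq> V" "card X = k" "finite X"
    using assms finite_subset by (auto simp: layer_def)
  have bound: "card (rel (T, j)) \<le> 4 * d * 2 ^ d" if "pairing V X T j" for T j
    unfolding rel_def using card_relevant_pairing[OF assms that] by simp
  have "pairing V X {} id" by (auto simp: pairing_def)
  \<comment> \<open>The bound on relevant pairs, uniform over all pairings, makes the maximum
    exist.\<close>
  then obtain T0 j where T0: "pairing V X T0 j"
    and max: "\<And>T' j'. pairing V X T' j' \<Longrightarrow> card (rel (T', j')) \<le> card (rel (T0, j))"
    using bound ex_has_greatest_nat[of "\<lambda>(T, j). pairing V X T j" "({}, id)"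
        "\<lambda>p. card (rel p)" "4 * d * 2 ^ d"]
    by fastforce
  define T where "T = rel (T0, j)"
  have pT: "pairing V X T j" and relT: "relevant T (pairing_fun \<phi> X T j) = T"
    unfolding T_def rel_def using relevant_pairing_restrict[OF X(3) T0] by auto
  have T: "T \<subseteq> X" "inj_on j T" "j ` T \<subseteq> V - X" using pT by (auto simp: pairing_def)
  have finT: "finite T" using T X finite_subset by blast
  have const: "\<phi> X' = \<phi> X" if X': "X' \<in> layer V k" "X' \<inter> (T \<union> j ` T) = X \<inter> (T \<union> j ` T)" for X'
  proof -
    define U where "U = X - X'"
    have X'V: "X' \<subseteq> V" "card X' = k" "finite X'"
      using X' assms finite_subset by (auto simp: layer_def)
    \<comment> \<open>Both points have \<open>k\<close> elements, so \<open>X - X'\<close> can be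
      matched with \<open>X' - X\<close>. These are the swaps leading from \<open>X\<close> to
      \<open>X'\<close>.\<close>
    have "card (X - X') + card (X \<inter> X') = card (X' - X) + card (X \<inter> X')"
      using X X'V card_Int_Diff[of X X'] card_Int_Diff[of X' X] by (simp add: Int_commute)
    then have "card U = card (X' - X)" by (simp add: U_def)
    then obtain l where l: "bij_betw l U (X' - X)"
      using X X'V finite_same_card_bij by (metis U_def finite_Diff)
    define j' where "j' = (\<lambda>i. if i \<in> T then j i else l i)"
    have TX': "T \<subseteq> X'" "j ` T \<inter> X' = {}" using X'(2) T by auto
    then have UT: "U \<inter> T = {}" by (auto simp: U_def)
    have jT: "j' ` S = j ` S" if "S \<subseteq> T" for S using that by (auto simp: j'_def subset_iff)
    have j'U: "j' i = l i" if "i \<in> U" for i using that UT by (auto simp: j'_def)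
    have jU: "j' ` U = X' - X"
      using j'U bij_betw_imp_surj_on[OF l] by (simp cong: image_cong)
    have inj: "inj_on j' (T \<union> U)"
    proof (rule inj_on_Un[THEN iffD2], intro conjI)
      show "inj_on j' T" using T(2) by (simp add: j'_def inj_on_def)
      show "inj_on j' U" using inj_on_cong[of U j' l, OF j'U] bij_betw_imp_inj_on[OF l] by blast
      have "j' ` T \<inter> j' ` U = {}" unfolding jU jT[OF order_refl] using TX' by auto
      then show "j' ` (T - U) \<inter> j' ` (U - T) = {}" by auto
    qed
    have pTU: "pairing V X (T \<union> U) j'"
    proof -
      have "T \<union> U \<subseteq> X" using T by (auto simp: U_def)
      moreover have "j' ` (T \<union> U) \<subseteq> V - X"
        unfolding image_Un jU jT[OF order_refl] using T X'V by blast
      ultimately show ?thesis using inj by (simp add: pairing_def)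
    qed
    let ?h = "pairing_fun \<phi> X (T \<union> U) j'"
    let ?R = "relevant (T \<union> U) ?h"
    \<comment> \<open>With the new pairs unswapped the old pairing function reappears, so the pairs
      of \<open>T\<close> stay relevant in the larger pairing.\<close>
    have hT: "?h (B \<union> U) = pairing_fun \<phi> X T j B" if "B \<subseteq> T" for B
    proof -
      have "T \<union> U - (B \<union> U) = T - B" using UT by auto
      moreover have "j' ` (T - B) = j ` (T - B)" by (rule jT) auto
      moreover have "B \<union> U \<union> j ` (T - B) \<union> (X - (T \<union> U)) = B \<union> j ` (T - B) \<union> (X - T)"
        using UT by (auto simp: U_def)
      ultimately show ?thesis by (simp add: pairing_fun_def)
    qed
    have "T \<subseteq> ?R"
    proof
      fix i assume i: "i \<in> T"
      then obtain B where B: "B \<subseteq> T"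
        "pairing_fun \<phi> X T j (insert i B) \<noteq> pairing_fun \<phi> X T j (B - {i})"
        using relT by (auto simp: relevant_def)
      have "?h (insert i B \<union> U) \<noteq> ?h ((B - {i}) \<union> U)"
      proof -
        have "insert i B \<subseteq> T" "B - {i} \<subseteq> T" using B(1) i by auto
        then show ?thesis using B(2) hT by metis
      qed
      moreover have "insert i B \<union> U = insert i (B \<union> U)" "(B - {i}) \<union> U = B \<union> U - {i}"
        using i UT by auto
      ultimately show "i \<in> ?R" using i B by (intro relevantI[of _ _ "B \<union> U"]) auto
    qed
    moreover have "card ?R \<le> card T"
      using max[OF pTU] by (simp add: rel_def T_def)
    moreover have finTU: "finite (T \<union> U)" using finT X by (auto simp: U_def)
    then have "finite ?R" by (rule finite_subset[rotated]) (auto simp: relevant_def)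
    ultimately have "?R = T" by (metis card_seteq)
    \<comment> \<open>The argument \<open>T\<close> swaps exactly the new pairs and gives
      \<open>X'\<close>; \<open>T \<union> U\<close> swaps nothing and gives
      \<open>X\<close>.\<close>
    then have "?h T = ?h (T \<union> U)"
      using UT by (intro relevant_determines[OF finTU]) auto
    moreover have "?h T = \<phi> X'"
    proof -
      have "T \<union> U - T = U" using UT by auto
      moreover have "T \<union> (X' - X) \<union> (X - (T \<union> U)) = X'" using TX' by (auto simp: U_def)
      ultimately show ?thesis by (simp add: pairing_fun_def jU)
    qed
    moreover have "?h (T \<union> U) = \<phi> X"
    proof -
      have "T \<union> U \<union> (X - (T \<union> U)) = X" using T by (auto simp: U_def)
      then show ?thesis by (simp add: pairing_fun_def)
    qed
    ultimately show ?thesis by simp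
  qed
  have "certifies V k \<phi> X (T \<union> j ` T)"
    unfolding certifies_def using T X const
    by (metis (no_types, lifting) Diff_subset le_sup_iff subset_trans)
  moreover have "card (T \<union> j ` T) \<le> 8 * d * 2 ^ d"
  proof -
    have "card (T \<union> j ` T) \<le> card T + card (j ` T)" by (rule card_Un_le)
    also have "\<dots> \<le> 2 * card T" using card_image_le[OF finT, of j] by simp
    also have "\<dots> \<le> 8 * d * 2 ^ d" using bound[OF T0] by (simp add: T_def)
    finally show ?thesis .
  qed
  ultimately show ?thesis by blast
qed

section \<open>Extension to the cube\<close>

text \<open>Otherwise the two patterns are compatible, and a layer point extending both would have
  both values.\<close>

lemma certificates_conflict:
  assumes "finite V" "certifies V k \<phi> X0 S0" "certifies V k \<phi> X1 S1"
    "X0 \<in> layer V k" "X1 \<in> layer V k" "\<phi> X0 \<noteq> \<phi> X1"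
    "card S0 + card S1 \<le> k" "k + (card S0 + card S1) \<le> card V"
  shows "\<exists>i\<in>S0 \<inter> S1. (i \<in> X0) \<noteq> (i \<in> X1)"
proof (rule ccontr)
  assume "\<not> ?thesis"
  then have agree: "i \<in> X0 \<longleftrightarrow> i \<in> X1" if "i \<in> S0" "i \<in> S1" for i using that by blast
  have sub: "S0 \<subseteq> V" "S1 \<subseteq> V" using assms(2,3) by (auto simp: certifies_def)
  have "card (S0 \<union> S1) \<le> card S0 + card S1" by (rule card_Un_le)
  then have "\<exists>X\<in>layer V k. X \<inter> (S0 \<union> S1) = (X0 \<inter> S0 \<union> X1 \<inter> S1) \<inter> (S0 \<union> S1)"
    using assms sub by (intro layer_extension) auto
  then obtain X where X: "X \<in> layer V k" "X \<inter> (S0 \<union> S1) = X0 \<inter> S0 \<union> X1 \<inter> S1" by blast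
  have "X \<inter> S0 = X0 \<inter> S0" "X \<inter> S1 = X1 \<inter> S1" using X(2) agree by blast+
  then have "\<phi> X = \<phi> X0" "\<phi> X = \<phi> X1"
    using assms X(1) unfolding certifies_def by blast+
  then show False using assms(6) by simp
qed

text \<open>Here \<open>Y\<close> need not have \<open>k\<close> elements. Adding to \<open>Q\<close> the certificate of a \<open>1\<close>-point that agrees
  with \<open>Y\<close> on \<open>Q\<close> forces every remaining \<open>0\<close>-certificate to meet \<open>Q\<close> in one more element, because
  it conflicts with the added certificate outside \<open>Q\<close>.\<close>

lemma cube_certificate:
  assumes "finite V" and bool: "\<phi> \<in> layer V k \<rightarrow> {0, 1}"
    and cert: "\<And>X. X \<in> layer V k \<Longrightarrow> \<exists>Q. certifies V k \<phi> X Q \<and> card Q \<le> c"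
    and large: "2 * c \<le> k" "k + 2 * c \<le> card V"
  shows "\<exists>Q. certifies V k \<phi> Y Q \<and> card Q \<le> c * Suc c"
proof -
  obtain S where S: "certifies V k \<phi> X (S X)" "card (S X) \<le> c" if "X \<in> layer V k" for X
    using cert by metis
  have finS: "finite (S X)" if "X \<in> layer V k" for X
    using S(1)[OF that] assms(1) finite_subset by (auto simp: certifies_def)
  \<comment> \<open>The progress measure: how far \<open>Q\<close> has already cut into the
    certificates of all \<open>0\<close>-points that are still consistent with \<open>Y\<close> on
    \<open>Q\<close>.\<close>
  define meets where "meets i Q \<longleftrightarrow>
    (\<forall>X\<in>layer V k. X \<inter> Q = Y \<inter> Q \<and> \<phi> X = 0 \<longrightarrow> i \<le> card (S X \<inter> Q))" for i Q
  have meetsD: "i \<le> card (S X \<inter> Q)"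
    if "meets i Q" "X \<in> layer V k" "X \<inter> Q = Y \<inter> Q" "\<phi> X = 0" for i Q X
    using that by (simp add: meets_def)
  have "(\<exists>Q. certifies V k \<phi> Y Q \<and> card Q \<le> i * c) \<or>
      (\<exists>Q\<subseteq>V. card Q \<le> i * c \<and> meets i Q)" for i
  proof (induction i)
    case 0
    then show ?case by (intro disjI2 exI[of _ "{}"]) (auto simp: meets_def)
  next
    case (Suc i)
    show ?case
    proof (cases "\<exists>Q. certifies V k \<phi> Y Q \<and> card Q \<le> i * c")
      case True
      then obtain Q where "certifies V k \<phi> Y Q" "card Q \<le> i * c" by blast
      moreover from this have "card Q \<le> Suc i * c" by simp
      ultimately show ?thesis by blast
    next
      case False
      then obtain Q where Q: "Q \<subseteq> V" "card Q \<le> i * c" and meets: "meets i Q"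
        using Suc by blast
      have finQ: "finite Q" using Q assms finite_subset by blast
      \<comment> \<open>Since \<open>Q\<close> is not yet a certificate, both values occur among the
        points consistent with it.\<close>
      obtain X1 where X1: "X1 \<in> layer V k" "X1 \<inter> Q = Y \<inter> Q" "\<phi> X1 = 1"
      proof -
        have "\<not> certifies V k \<phi> Y Q" using False Q(2) by blast
        then obtain X X' where "X \<in> layer V k" "X' \<in> layer V k" "X \<inter> Q = Y \<inter> Q" "X' \<inter> Q = Y \<inter> Q"
          "\<phi> X \<noteq> \<phi> X'"
          unfolding certifies_def using Q(1) by blast
        moreover from this have "\<phi> X \<in> {0, 1}" "\<phi> X' \<in> {0, 1}" using bool by auto
        ultimately show ?thesis using that by auto
      qed
      let ?Q = "Q \<union> S X1"
      have "Suc i \<le> card (S X \<inter> ?Q)"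
        if X: "X \<in> layer V k" "X \<inter> ?Q = Y \<inter> ?Q" "\<phi> X = 0" for X
      proof -
        have XQ: "X \<inter> Q = Y \<inter> Q" using X(2) by blast
        have "\<exists>i\<in>S X \<inter> S X1. (i \<in> X) \<noteq> (i \<in> X1)"
          using S[OF X(1)] S[OF X1(1)] X X1 large
          by (intro certificates_conflict[OF assms(1)]) auto
        then obtain e where e: "e \<in> S X" "e \<in> S X1" "(e \<in> X) \<noteq> (e \<in> X1)" by blast
        then have "e \<notin> Q" using XQ X1(2) by blast
        then have "card (S X \<inter> Q) < card (S X \<inter> ?Q)"
          using e finS[OF X(1)] by (intro psubset_card_mono) auto
        then show ?thesis using meetsD[OF meets X(1) XQ X(3)] by simp
      qed
      then have "meets (Suc i) ?Q" by (simp add: meets_def)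
      moreover have "card ?Q \<le> Suc i * c"
        using card_Un_le[of Q "S X1"] Q S(2)[OF X1(1)] by simp
      moreover have "?Q \<subseteq> V" using Q S(1)[OF X1(1)] by (auto simp: certifies_def)
      ultimately show ?thesis by blast
    qed
  qed
  \<comment> \<open>No certificate has \<open>c + 1\<close> elements, so after \<open>c + 1\<close>
    rounds no consistent \<open>0\<close>-point is left and \<open>Q\<close> certifies the value
    1.\<close>
  from this[of "Suc c"] show ?thesis
  proof
    assume "\<exists>Q. certifies V k \<phi> Y Q \<and> card Q \<le> Suc c * c"
    then show ?thesis by (simp only: mult.commute)
  next
    assume "\<exists>Q\<subseteq>V. card Q \<le> Suc c * c \<and> meets (Suc c) Q"
    then obtain Q where Q: "Q \<subseteq> V" "card Q \<le> Suc c * c" and meets: "meets (Suc c) Q"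
      by blast
    have one: "\<phi> X = 1" if X: "X \<in> layer V k" "X \<inter> Q = Y \<inter> Q" for X
    proof -
      have "card (S X \<inter> Q) \<le> card (S X)" using finS[OF X(1)] by (intro card_mono) auto
      then have "\<phi> X \<noteq> 0" using meetsD[OF meets X] S(2)[OF X(1)] by linarith
      then show ?thesis using bool X(1) by auto
    qed
    have "certifies V k \<phi> Y Q" unfolding certifies_def using Q(1) one by auto
    then show ?thesis using Q(2) by (auto simp: mult.commute)
  qed
qed

text \<open>\<open>F Y\<close> is the value of \<open>\<phi>\<close> forced by a certificate for \<open>Y\<close>. A difference of order \<open>d + 1\<close> of \<open>F\<close>
  involves \<open>2 ^ (d + 1)\<close> certificates; pairing its directions with coordinates outside all of them
  turns it into a difference of \<open>\<phi>\<close> along a cube in the layer.\<close>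

lemma cube_extension:
  fixes d :: nat
  defines "c \<equiv> 8 * d * 2 ^ d"
  assumes "finite V" and deg: "slice_deg_le V k d \<phi>" and bool: "\<phi> \<in> layer V k \<rightarrow> {0, 1}"
    and large: "2 ^ Suc d * (c * Suc c) + 2 * Suc d \<le> k"
      "k + (2 ^ Suc d * (c * Suc c) + 2 * Suc d) \<le> card V"
  obtains F where "\<And>X. X \<in> layer V k \<Longrightarrow> F X = \<phi> X" "\<And>Y. F Y \<in> {0, 1}" "deg_le V d F"
proof -
  \<comment> \<open>\<open>M\<close> bounds the union of the \<open>2 ^ Suc d\<close> certificates;
    the extra \<open>2 * Suc d\<close> is room for the directions \<open>S\<close> and their
    partners \<open>J\<close>.\<close>
  define M where "M = 2 ^ Suc d * (c * Suc c)"
  have largeM: "M + 2 * Suc d \<le> k" "k + (M + 2 * Suc d) \<le> card V"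
    using large unfolding M_def .
  have "1 \<le> 2 ^ d * Suc c" by (simp only: One_nat_def Suc_le_eq) simp
  then have "1 * (2 * c) \<le> (2 ^ d * Suc c) * (2 * c)" by (rule mult_right_mono) auto
  also have "(2 ^ d * Suc c) * (2 * c) = M" by (simp add: M_def algebra_simps)
  finally have "2 * c \<le> M" by simp
  then have c: "2 * c \<le> k" "k + 2 * c \<le> card V" using largeM by linarith+
  have "\<exists>Q. certifies V k \<phi> Y Q \<and> card Q \<le> c * Suc c" for Y
    using layer_certificate[OF assms(2) _ deg bool] c
    by (intro cube_certificate[OF assms(2) bool]) (auto simp: c_def)
  then obtain Q where Q: "certifies V k \<phi> Y (Q Y)" "card (Q Y) \<le> c * Suc c" for Y by metis
  have "1 * (c * Suc c) \<le> M" unfolding M_def by (rule mult_right_mono) auto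
  then have Qk: "card (Q Y) \<le> k" "k + card (Q Y) \<le> card V" for Y using Q(2)[of Y] largeM by linarith+
  have QV: "Q Y \<subseteq> V" for Y using Q(1) by (auto simp: certifies_def)
  have "\<exists>X\<in>layer V k. X \<inter> Q Y = Y \<inter> Q Y" for Y
    using Qk QV assms(2) by (intro layer_extension) auto
  then obtain P where P: "P Y \<in> layer V k" "P Y \<inter> Q Y = Y \<inter> Q Y" for Y by metis
  define F where "F = (\<lambda>Y. \<phi> (P Y))"
  \<comment> \<open>Any layer point agreeing with \<open>Y\<close> on \<open>Q Y\<close> may replace
    \<open>P Y\<close>. In particular \<open>F\<close> extends \<open>\<phi>\<close>.\<close>
  have F: "F Y = \<phi> X" if "X \<in> layer V k" "X \<inter> Q Y = Y \<inter> Q Y" for X Y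
    using that P[of Y] Q(1)[of Y] unfolding F_def certifies_def by metis
  have "deg_le V d F"
    unfolding deg_le_def
  proof (intro allI impI, elim conjE)
    fix S R assume SR: "S \<subseteq> V" "R \<subseteq> V - S" "card S = Suc d"
    then have finS: "finite S" by (simp add: card_ge_0_finite)
    define Q' where "Q' = (\<Union>B\<in>Pow S. Q (B \<union> R))"
    have Q'V: "Q' \<subseteq> V" using QV by (auto simp: Q'_def)
    have "card Q' \<le> (\<Sum>B\<in>Pow S. card (Q (B \<union> R)))"
      unfolding Q'_def using finS by (intro card_UN_le) auto
    also have "\<dots> \<le> (\<Sum>B\<in>Pow S. c * Suc c)" by (intro sum_mono Q(2))
    also have "\<dots> = M" using finS SR by (simp add: M_def card_Pow)
    finally have "card Q' \<le> M" .
    then have Q'S: "card (Q' \<union> S) \<le> M + Suc d"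
      using card_Un_le[of Q' S] SR by linarith
    have finQ'S: "finite (Q' \<union> S)" using Q'V finS assms(2) finite_subset by auto
    have "card (V - (Q' \<union> S)) = card V - card (Q' \<union> S)"
      using Q'V SR finQ'S by (intro card_Diff_subset) auto
    then have "card S \<le> card (V - (Q' \<union> S))" using Q'S largeM(2) SR(3) by arith
    then obtain J where J: "J \<subseteq> V - (Q' \<union> S)" "card J = card S" "finite J"
      by (metis obtain_subset_with_card_n)
    then obtain l where l: "bij_betw l S J" using finS finite_same_card_bij by metis
    have "card (Q' \<union> S \<union> J) \<le> M + 2 * Suc d"
      using card_Un_le[of "Q' \<union> S" J] Q'S J(2) SR(3) by arith
    then have small: "card (Q' \<union> S \<union> J) \<le> k" "k + card (Q' \<union> S \<union> J) \<le> card V"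
      using largeM by arith+
    have "Q' \<union> S \<union> J \<subseteq> V" using Q'V SR(1) J(1) by auto
    \<comment> \<open>The point with all pairs swapped, for \<open>B = {}\<close>: it contains
      \<open>J\<close>, misses \<open>S\<close> and agrees with \<open>R\<close> on the rest of
      \<open>Q'\<close>.\<close>
    from layer_extension[OF assms(2) this small]
    have "\<exists>X\<in>layer V k. X \<inter> (Q' \<union> S \<union> J) = (R \<inter> Q' \<union> J) \<inter> (Q' \<union> S \<union> J)" .
    then obtain X where X: "X \<in> layer V k" "X \<inter> (Q' \<union> S \<union> J) = R \<inter> Q' \<union> J" by blast
    define W where "W = X - J"
    have JX: "J \<subseteq> X" using X(2) by blast
    have "S \<inter> X = {}" using X(2) SR J by blast
    then have W: "W \<subseteq> V - S - l ` S" "S \<inter> W = {}"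
      using X(1) bij_betw_imp_surj_on[OF l] by (auto simp: W_def layer_def)
    have lS: "inj_on l S" "l ` S \<subseteq> V - S" "S \<subseteq> V"
      using J(1) bij_betw_imp_surj_on[OF l] bij_betw_imp_inj_on[OF l] SR by auto
    have "card W = card X - card J" unfolding W_def using J JX by (intro card_Diff_subset)
    moreover have "card J \<le> card X"
      using JX X(1) assms(2) finite_subset by (intro card_mono) (auto simp: layer_def)
    ultimately have card: "card S + card W = k" using X(1) J by (simp add: layer_def)
    have "F (B \<union> R) = \<phi> (B \<union> l ` (S - B) \<union> W)" if "B \<in> Pow S" for B
    proof (rule F)
      have "B \<subseteq> S" using that by auto
      then show "B \<union> l ` (S - B) \<union> W \<in> layer V k"
        by (intro pairing_in_layer assms(2) lS W card)
      \<comment> \<open>The partners lie outside \<open>Q'\<close>, so the certificate of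
        \<open>B \<union> R\<close> cannot tell this layer point from
        \<open>B \<union> R\<close>.\<close>
      have sub: "Q (B \<union> R) \<subseteq> Q'" using that by (auto simp: Q'_def)
      have "l ` (S - B) \<subseteq> J" using bij_betw_imp_surj_on[OF l] by blast
      then have "l ` (S - B) \<inter> Q (B \<union> R) = {}" using sub J(1) by blast
      moreover have "W \<inter> Q (B \<union> R) = R \<inter> Q (B \<union> R)"
        unfolding W_def using X(2) sub J(1) by blast
      ultimately show "(B \<union> l ` (S - B) \<union> W) \<inter> Q (B \<union> R) = (B \<union> R) \<inter> Q (B \<union> R)"
        by blast
    qed
    then have "(\<Sum>B\<in>Pow S. (-1) ^ card B * F (B \<union> R)) =
        (\<Sum>B\<in>Pow S. (-1) ^ card B * \<phi> ((B \<union> {}) \<union> l ` (S - (B \<union> {})) \<union> W))"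
      by (intro sum.cong) auto
    also have "\<dots> = 0"
    proof (rule deg_leD)
      show "deg_le S d (\<lambda>B. \<phi> (B \<union> l ` (S - B) \<union> W))"
        using deg lS W(1) card unfolding slice_deg_le_def by blast
    qed (use SR in auto)
    finally show "(\<Sum>B\<in>Pow S. (-1) ^ card B * F (B \<union> R)) = 0" .
  qed
  moreover have "F Y \<in> {0, 1}" for Y unfolding F_def using bool P(1) by auto
  ultimately show ?thesis using that F by blast
qed

section \<open>Polynomials and juntas\<close>

lemma card_keys_le_total_degree:
  assumes "m \<in> Poly_Mapping.keys p"
  shows "card (Poly_Mapping.keys m) \<le> total_degree p"
proof -
  have "card (Poly_Mapping.keys m) = (\<Sum>i\<in>Poly_Mapping.keys m. 1)" by simp
  also have "\<dots> \<le> monom_deg m"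
    unfolding monom_deg_def by (rule sum_mono) (simp add: in_keys_iff)
  also have "\<dots> \<le> total_degree p"
    unfolding total_degree_def using assms by (intro Max_ge) auto
  finally show ?thesis .
qed

text \<open>\<open>own v\<close> is the only element of \<open>S\<close> whose membership in \<open>B\<close> may influence the coordinate \<open>v\<close> of
  \<open>X B\<close>. A monomial with fewer than \<open>card S\<close> variables misses some element of \<open>S\<close>, and so cancels.\<close>

lemma alternating_sum_mpoly_eval:
  fixes X :: "nat set \<Rightarrow> nat \<Rightarrow> real" and own :: "nat \<Rightarrow> nat"
  assumes "finite S" "total_degree p < card S"
    and own: "\<And>i B v. i \<in> S \<Longrightarrow> B \<subseteq> S - {i} \<Longrightarrow> v \<in> mpoly_vars p \<Longrightarrow> own v \<noteq> i \<Longrightarrow>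
      X (insert i B) v = X B v"
  shows "(\<Sum>B\<in>Pow S. (-1) ^ card B * mpoly_eval p (X B)) = 0"
proof -
  let ?K = "Poly_Mapping.keys p"
  have "(\<Sum>B\<in>Pow S. (-1) ^ card B * mpoly_eval p (X B)) =
      (\<Sum>B\<in>Pow S. \<Sum>m\<in>?K. Poly_Mapping.lookup p m * ((-1) ^ card B * monom_eval m (X B)))"
    by (simp add: mpoly_eval_def sum_distrib_left ac_simps)
  also have "\<dots> = (\<Sum>m\<in>?K. Poly_Mapping.lookup p m *
      (\<Sum>B\<in>Pow S. (-1) ^ card B * monom_eval m (X B)))"
    by (subst sum.swap) (simp add: sum_distrib_left)
  also have "\<dots> = 0"
  proof (intro sum.neutral ballI)
    fix m assume m: "m \<in> ?K"
    let ?V = "Poly_Mapping.keys m"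
    have "card (own ` ?V) \<le> card ?V" by (rule card_image_le) simp
    also have "\<dots> < card S" using card_keys_le_total_degree[OF m] assms(2) by simp
    finally have "\<not> S \<subseteq> own ` ?V" by (metis card_mono finite_imageI finite_keys not_le)
    then obtain i where i: "i \<in> S" "i \<notin> own ` ?V" by blast
    have "monom_eval m (X (insert i B)) = monom_eval m (X B)" if "B \<subseteq> S - {i}" for B
      unfolding monom_eval_def
    proof (rule prod.cong[OF refl])
      fix v assume v: "v \<in> ?V"
      then have "X (insert i B) v = X B v"
        using i m that by (intro own) (auto simp: mpoly_vars_def)
      then show "X (insert i B) v ^ Poly_Mapping.lookup m v = X B v ^ Poly_Mapping.lookup m v"
        by simp
    qed
    then have "(\<Sum>B\<in>Pow S. (-1) ^ card B * monom_eval m (X B)) = 0"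
      using assms(1) i by (intro alternating_sum_cancel)
    then show "Poly_Mapping.lookup p m * (\<Sum>B\<in>Pow S. (-1) ^ card B * monom_eval m (X B)) = 0"
      by simp
  qed
  finally show ?thesis .
qed

section \<open>Translation between points and sets of ones\<close>

lemma cube_point_in_slice: "X \<in> layer {1..n} k \<Longrightarrow> cube_point n X \<in> slice n k"
  using cube_point_in[of n X]
  by (auto simp: slice_def layer_def cube_point_def sum.If_cases Int_absorb1)

lemma ones_in_layer:
  assumes "x \<in> slice n k"
  shows "{i\<in>{1..n}. x i = 1} \<in> layer {1..n} k"
proof -
  let ?A = "{i\<in>{1..n}. x i = 1}"
  have x: "x = cube_point n ?A" using assms by (intro hypercube_eq_cube_point) (simp add: slice_def)
  have "real k = (\<Sum>i=1..n. x i)" using assms by (simp add: slice_def)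
  also have "\<dots> = (\<Sum>i=1..n. if i \<in> ?A then 1 else 0)"
    by (subst x) (rule sum.cong, auto simp: cube_point_def)
  also have "\<dots> = real (card ?A)" by (simp add: sum.If_cases Int_def)
  finally have "card ?A = k" by (simp only: of_nat_eq_iff)
  then show ?thesis by (auto simp: layer_def)
qed

text \<open>Substituting \<open>1 - x i\<close> for the coordinate \<open>j i\<close> in a
  polynomial representing \<open>f\<close> does not raise its degree.\<close>

lemma slice_degree_imp_slice_deg_le:
  assumes "slice_degree n k f \<le> d"
  shows "slice_deg_le {1..n} k d (\<lambda>A. f (cube_point n A))"
  unfolding slice_deg_le_def
proof (intro allI impI, elim conjE)
  fix T j W
  assume T: "T \<subseteq> {1..n}" "inj_on j T" "j ` T \<subseteq> {1..n} - T" and W: "W \<subseteq> {1..n} - T - j ` T"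
    and card: "card T + card W = k"
  have "\<exists>d p. mpoly_vars p \<subseteq> {1..n} \<and> total_degree p = d \<and> (\<forall>x\<in>slice n k. mpoly_eval p x = f x)"
    using ex_slice_polynomial[of n k f] by blast
  from LeastI_ex[OF this] obtain p where p: "mpoly_vars p \<subseteq> {1..n}" "total_degree p \<le> d"
    "\<And>x. x \<in> slice n k \<Longrightarrow> mpoly_eval p x = f x"
    using assms unfolding slice_degree_def by auto
  have finT: "finite T" using T finite_subset by blast
  show "deg_le T d (\<lambda>B. f (cube_point n (B \<union> j ` (T - B) \<union> W)))"
    unfolding deg_le_def
  proof (intro allI impI, elim conjE)
    fix S R assume SR: "S \<subseteq> T" "R \<subseteq> T - S" "card S = Suc d"
    let ?X = "\<lambda>B. cube_point n ((B \<union> R) \<union> j ` (T - (B \<union> R)) \<union> W)"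
    \<comment> \<open>Both \<open>i\<close> and its partner \<open>j i\<close> are controlled by
      \<open>i\<close>.\<close>
    define own where "own v = (if v \<in> j ` T then inv_into T j v else v)" for v
    have "(\<Sum>B\<in>Pow S. (-1) ^ card B * f (?X B)) =
        (\<Sum>B\<in>Pow S. (-1) ^ card B * mpoly_eval p (?X B))"
    proof (intro sum.cong refl arg_cong2[where f = "(*)"] p(3)[symmetric] cube_point_in_slice)
      fix B assume "B \<in> Pow S"
      then show "(B \<union> R) \<union> j ` (T - (B \<union> R)) \<union> W \<in> layer {1..n} k"
        using SR by (intro pairing_in_layer T W card) auto
    qed
    also have "\<dots> = 0"
    proof (rule alternating_sum_mpoly_eval[where own = own])
      show "finite S" using SR finT finite_subset by blast
      show "total_degree p < card S" using SR p by simp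
      fix i B v assume i: "i \<in> S" and B: "B \<subseteq> S - {i}" and v: "own v \<noteq> i"
      have iT: "i \<in> T" "i \<notin> j ` T" using i SR T by auto
      then have "v \<noteq> i" using v by (auto simp: own_def)
      moreover have "v \<noteq> j i" using v iT T(2) by (auto simp: own_def)
      ultimately have "v \<in> (insert i B \<union> R) \<union> j ` (T - (insert i B \<union> R)) \<union> W \<longleftrightarrow>
          v \<in> (B \<union> R) \<union> j ` (T - (B \<union> R)) \<union> W"
        by blast
      then show "?X (insert i B) v = ?X B v" by (simp add: cube_point_def)
    qed
    finally show "(\<Sum>B\<in>Pow S. (-1) ^ card B * f (?X B)) = 0" .
  qed
qed

text \<open>Forwards, each coordinate is its own owner in \<open>alternating_sum_mpoly_eval\<close>.
  Backwards, Moebius inversion gives the coefficient of a monomial with variable set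
  \<open>A\<close>, up to sign, as a difference of order \<open>card A\<close>, which vanishes
  beyond \<open>d\<close>.\<close>

lemma cube_degree_le_iff:
  "cube_degree n g \<le> d \<longleftrightarrow> deg_le {1..n} d (\<lambda>A. g (cube_point n A))"
proof -
  let ?h = "\<lambda>A. g (cube_point n A)"
  define p where "p = (THE p. is_multilinear_rep n g p)"
  have "is_multilinear_rep n g p"
    unfolding p_def by (rule theI') (rule ex1_multilinear_rep)
  then have ml: "multilinear p" and vars: "mpoly_vars p \<subseteq> {1..n}"
    and eval: "mpoly_eval p (cube_point n A) = ?h A" for A
    by (auto simp: is_multilinear_rep_def)
  have "total_degree p \<le> d \<longleftrightarrow> deg_le {1..n} d ?h"
  proof
    assume p: "total_degree p \<le> d"
    show "deg_le {1..n} d ?h"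
      unfolding deg_le_def eval[symmetric]
    proof (intro allI impI, elim conjE)
      fix S R assume "S \<subseteq> {1..n}" "R \<subseteq> {1..n} - S" "card S = Suc d"
      then show "(\<Sum>B\<in>Pow S. (-1) ^ card B * mpoly_eval p (cube_point n (B \<union> R))) = 0"
        using p finite_subset
        by (intro alternating_sum_mpoly_eval[where own = "\<lambda>v. v"]) (auto simp: cube_point_def)
    qed
  next
    assume h: "deg_le {1..n} d ?h"
    have "monom_deg m \<le> d" if m: "m \<in> Poly_Mapping.keys p" for m
    proof (rule ccontr)
      assume large: "\<not> monom_deg m \<le> d"
      define A where "A = Poly_Mapping.keys m"
      have A: "A \<subseteq> {1..n}" "finite A" using vars m by (auto simp: A_def mpoly_vars_def)
      have mA: "m = sqfree_monom A" unfolding A_def by (rule multilinear_key[OF ml m])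
      have "monom_deg m = card A"
        unfolding monom_deg_def A_def[symmetric] by (simp add: mA lookup_sqfree_monom[OF A(2)])
      then obtain e where e: "card A = Suc e" "d \<le> e" using large by (cases "card A") auto
      have "(-1) ^ card A * Poly_Mapping.lookup p m =
          (\<Sum>B\<in>Pow A. (-1) ^ card B * (\<Sum>D\<in>Pow B. Poly_Mapping.lookup p (sqfree_monom D)))"
        unfolding alternating_sum_moebius[OF A(2)] mA ..
      also have "\<dots> = (\<Sum>B\<in>Pow A. (-1) ^ card B * ?h (B \<union> {}))"
      proof (rule sum.cong[OF refl])
        fix B assume "B \<in> Pow A"
        then have "B \<subseteq> {1..n}" using A by auto
        then show "(-1) ^ card B * (\<Sum>D\<in>Pow B. Poly_Mapping.lookup p (sqfree_monom D)) =
            (-1) ^ card B * ?h (B \<union> {})"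
          using mpoly_eval_multilinear[OF ml vars] eval by simp
      qed
      also have "\<dots> = 0"
        by (rule deg_leD[OF deg_le_mono[OF _ h e(2)]]) (use A e in auto)
      finally show False using m by (simp add: in_keys_iff)
    qed
    then show "total_degree p \<le> d" unfolding total_degree_def by auto
  qed
  then show ?thesis by (simp add: cube_degree_def p_def)
qed

lemma depends_on_eq_relevant:
  "{i\<in>{1..n}. depends_on n g i} = relevant {1..n} (\<lambda>A. g (cube_point n A))"
proof (intro equalityI subsetI)
  fix i assume "i \<in> {i\<in>{1..n}. depends_on n g i}"
  then obtain x y where i: "i \<in> {1..n}" and xy: "x \<in> hypercube n" "y \<in> hypercube n"
    "\<And>j. j \<in> {1..n} - {i} \<Longrightarrow> x j = y j" "g x \<noteq> g y"
    by (auto simp: depends_on_def)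
  define A where "A = {j\<in>{1..n}. x j = 1}"
  define A' where "A' = {j\<in>{1..n}. y j = 1}"
  have x: "x = cube_point n A" "y = cube_point n A'"
    unfolding A_def A'_def by (rule hypercube_eq_cube_point, rule xy)+
  have AA': "A - {i} = A' - {i}" using xy(3) by (auto simp: A_def A'_def)
  \<comment> \<open>\<open>A\<close> and \<open>A'\<close> are each an endpoint of the same edge in
    direction \<open>i\<close>; as the values differ, they are the two distinct ones.\<close>
  have cases: "D = insert i D \<or> D = D - {i}" for D by auto
  have "g (cube_point n (insert i A)) \<noteq> g (cube_point n (A - {i}))"
    using xy(4) AA' cases[of A] cases[of A'] unfolding x by (metis insert_Diff_single)
  then show "i \<in> relevant {1..n} (\<lambda>A. g (cube_point n A))"
    using i by (intro relevantI[of _ _ A]) (auto simp: A_def)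
next
  fix i assume "i \<in> relevant {1..n} (\<lambda>A. g (cube_point n A))"
  then obtain B where i: "i \<in> {1..n}"
    and B: "g (cube_point n (insert i B)) \<noteq> g (cube_point n (B - {i}))"
    by (auto simp: relevant_def)
  have "\<forall>j\<in>{1..n} - {i}. cube_point n (insert i B) j = cube_point n (B - {i}) j"
    by (auto simp: cube_point_def)
  then show "i \<in> {i\<in>{1..n}. depends_on n g i}"
    using i B unfolding depends_on_def by (blast intro: cube_point_in)
qed

section \<open>The junta and the constant\<close>

lemma card_relevant_le_gamma:
  assumes "g \<in> hypercube n \<rightarrow> {0, 1}" "deg_le {1..n} d (\<lambda>A. g (cube_point n A))"
  shows "card (relevant {1..n} (\<lambda>A. g (cube_point n A))) \<le> gamma d"
  unfolding gamma_def
proof (rule Max_ge)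
  \<comment> \<open>This bound supplies the finiteness that makes \<open>Max\<close> in
    \<open>gamma\<close> an upper bound.\<close>
  have bound: "card (relevant {1..n} (\<lambda>A. g (cube_point n A))) \<le> 4 * d * 2 ^ d"
    if "g \<in> hypercube n \<rightarrow> {0, 1}" "cube_degree n g \<le> d" for n g
    using that by (intro card_relevant_le) (auto simp: cube_degree_le_iff Pi_iff)
  show "finite {card {i\<in>{1..n}. depends_on n g i} | n g.
      g \<in> hypercube n \<rightarrow> {0, 1} \<and> cube_degree n g \<le> d}"
    by (rule finite_subset[of _ "{..4 * d * 2 ^ d}"])
      (auto simp only: depends_on_eq_relevant atMost_iff finite_atMost intro: bound)
  show "card (relevant {1..n} (\<lambda>A. g (cube_point n A))) \<in>
      {card {i\<in>{1..n}. depends_on n g i} | n g. g \<in> hypercube n \<rightarrow> {0, 1} \<and> cube_degree n g \<le> d}"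
    using assms unfolding depends_on_eq_relevant cube_degree_le_iff by blast
qed

text \<open>The extension \<open>F\<close> is a function of degree at most \<open>d\<close> on the
  whole cube, so \<open>gamma\<close> bounds its relevant coordinates, and these also determine
  \<open>f\<close>.\<close>

lemma slice_junta_gamma:
  fixes d :: nat
  defines "c \<equiv> 8 * d * 2 ^ d"
  assumes bool: "f \<in> slice n k \<rightarrow> {0, 1}" and deg: "slice_degree n k f \<le> d"
    and large: "2 ^ Suc d * (c * Suc c) + 2 * Suc d \<le> k"
      "k + (2 ^ Suc d * (c * Suc c) + 2 * Suc d) \<le> n"
  shows "slice_junta n k (gamma d) f"
proof -
  let ?V = "{1..n}"
  obtain F where F: "\<And>X. X \<in> layer ?V k \<Longrightarrow> F X = f (cube_point n X)"
    and F01: "\<And>Y. F Y \<in> {0, 1}" and degF: "deg_le ?V d F"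
  proof (rule cube_extension[of ?V k d "\<lambda>A. f (cube_point n A)"])
    show "slice_deg_le ?V k d (\<lambda>A. f (cube_point n A))"
      using deg by (rule slice_degree_imp_slice_deg_le)
    show "(\<lambda>A. f (cube_point n A)) \<in> layer ?V k \<rightarrow> {0, 1}"
      using bool cube_point_in_slice by (auto simp: Pi_iff)
  qed (use large in \<open>auto simp: c_def\<close>)
  define g where "g x = F {i\<in>?V. x i = 1}" for x :: "nat \<Rightarrow> real"
  have g: "g (cube_point n A) = F (A \<inter> ?V)" for A
    unfolding g_def by (rule arg_cong[of _ _ F]) (auto simp: cube_point_def)
  define I where "I = relevant ?V (\<lambda>A. g (cube_point n A))"
  have "deg_le ?V d (\<lambda>A. g (cube_point n A))"
    unfolding deg_le_def
  proof (intro allI impI, elim conjE)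
    fix S R assume SR: "S \<subseteq> ?V" "R \<subseteq> ?V - S" "card S = Suc d"
    have "(B \<union> R) \<inter> ?V = B \<union> R" if "B \<in> Pow S" for B using SR that by auto
    then show "(\<Sum>B\<in>Pow S. (-1) ^ card B * g (cube_point n (B \<union> R))) = 0"
      using deg_leD[OF degF SR] by (simp add: g)
  qed
  then have "card I \<le> gamma d"
    unfolding I_def using F01 by (intro card_relevant_le_gamma) (auto simp: g_def)
  moreover have I: "I \<subseteq> ?V" by (auto simp: I_def relevant_def)
  moreover have "f x = F {i\<in>I. restrict x I i = 1}" if x: "x \<in> slice n k" for x
  proof -
    define A where "A = {i\<in>?V. x i = 1}"
    have A: "A \<in> layer ?V k" unfolding A_def using x by (rule ones_in_layer)
    have "x = cube_point n A"
      unfolding A_def using x by (intro hypercube_eq_cube_point) (simp add: slice_def)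
    then have "f x = F A" using F[OF A] by simp
    also have "\<dots> = g (cube_point n A)" using A by (simp add: g layer_def Int_absorb2)
    \<comment> \<open>\<open>A \<inter> I\<close> may have fewer than \<open>k\<close> elements;
      evaluating there is possible because \<open>F\<close> is defined off the slice.\<close>
    also have "\<dots> = g (cube_point n (A \<inter> I))"
      by (rule relevant_determines[of ?V]) (use A in \<open>auto simp: layer_def I_def\<close>)
    also have "\<dots> = F {i\<in>I. restrict x I i = 1}"
      unfolding g by (rule arg_cong[of _ _ F]) (use I in \<open>auto simp: A_def\<close>)
    finally show ?thesis .
  qed
  ultimately show ?thesis
    unfolding slice_junta_def using F01
    by (intro exI[of _ I] conjI bexI[of _ "\<lambda>y. F {i\<in>I. y i = 1}"]) auto
qed

text \<open>With \<open>t = 2 ^ d\<close> one has \<open>d + 1 \<le> t\<close> and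
  \<open>c \<le> 8 * t * t\<close>, so the left side is at most \<open>146 * t ^ 5\<close>, and
  \<open>t \<ge> 2\<close> gives \<open>146 \<le> t ^ 11\<close>.\<close>

lemma threshold_le:
  fixes d :: nat
  defines "c \<equiv> 8 * d * 2 ^ d"
  assumes "d \<ge> 1"
  shows "2 ^ Suc d * (c * Suc c) + 2 * Suc d \<le> (2 ^ 16) ^ d"
proof -
  define t :: nat where "t = 2 ^ d"
  have dt: "Suc d \<le> t" unfolding t_def using less_exp[of d] by (simp only: Suc_le_eq)
  have t2: "2 \<le> t" using dt assms(2) by linarith
  have c: "c \<le> 8 * t * t"
    unfolding c_def t_def[symmetric] using dt by (intro mult_right_mono mult_left_mono) auto
  have t8: "8 * t * t + 1 \<le> 9 * t * t" using t2 mult_mono[OF t2 t2] by (simp add: mult.assoc)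
  have "c * Suc c \<le> (8 * t * t) * (9 * t * t)"
    by (rule mult_mono) (use c t8 in linarith)+
  then have "(2 * t) * (c * Suc c) \<le> (2 * t) * ((8 * t * t) * (9 * t * t))"
    by (rule mult_le_mono2)
  moreover have "2 ^ Suc d = 2 * t" by (simp add: t_def)
  ultimately have "2 ^ Suc d * (c * Suc c) \<le> (2 * t) * ((8 * t * t) * (9 * t * t))"
    by (simp only:)
  also have "\<dots> = 144 * (t * t * t * t * t)" by simp
  also have "t * t * t * t * t = t ^ 5" by (simp add: numeral_eq_Suc)
  finally have "2 ^ Suc d * (c * Suc c) + 2 * Suc d \<le> 144 * t ^ 5 + 2 * t"
    by (rule add_le_mono) (rule mult_le_mono2[OF dt])
  also have "\<dots> \<le> 144 * t ^ 5 + 2 * t ^ 5"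
    using self_le_power[of t 5] t2 by simp
  also have "\<dots> \<le> 2 ^ 11 * t ^ 5" by simp
  also have "\<dots> \<le> t ^ 11 * t ^ 5" by (rule mult_le_mono1) (rule power_mono[OF t2], simp)
  also have "\<dots> = t ^ 16" by (simp flip: power_add)
  also have "\<dots> = (2 ^ 16) ^ d"
    unfolding t_def by (simp only: power_mult[symmetric] mult.commute)
  finally show ?thesis .
qed

theorem theorem1p1:
  shows "\<exists>C::real. \<forall>d::nat. d \<ge> 1 \<longrightarrow> (\<forall>(n::nat) (k::nat) (f :: (nat \<Rightarrow> real) \<Rightarrow> real).
    C ^ d \<le> real k \<and> real k \<le> real n - C ^ d \<and>
    f \<in> slice n k \<rightarrow> {0, 1} \<and> slice_degree n k f \<le> d \<longrightarrow>
      slice_junta n k (gamma d) f)"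
proof (intro exI[of _ "2 ^ 16"] allI impI, elim conjE)
  fix d n k :: nat and f :: "(nat \<Rightarrow> real) \<Rightarrow> real"
  assume d: "d \<ge> 1" and k: "(2 ^ 16) ^ d \<le> real k" "real k \<le> real n - (2 ^ 16) ^ d"
    and f: "f \<in> slice n k \<rightarrow> {0, 1}" "slice_degree n k f \<le> d"
  have pow: "real ((2 ^ 16) ^ d) = (2 ^ 16) ^ d" by simp
  have "real ((2 ^ 16) ^ d) \<le> real k" "real (k + (2 ^ 16) ^ d) \<le> real n"
    using k unfolding of_nat_add pow by linarith+
  then have "(2 ^ 16) ^ d \<le> k" "k + (2 ^ 16) ^ d \<le> n" unfolding of_nat_le_iff by blast+
  then show "slice_junta n k (gamma d) f"
    using threshold_le[OF d] by (intro slice_junta_gamma[OF f]) linarith+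
qed

end
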